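(* Suppose $X(\le d)$ is a $\gamma$-HDX with $d \ge k + l$ and $k \le l$. Then the largest non-trivial singular value $\sigma_2(\mathsf{S}_{k,l})$ of the swap operator $\mathsf{S}_{k,l}$ is \[ \sigma_2(\mathsf{S}_{k,l}) ~\le~ \sqrt{\gamma \cdot \left(2^8 \cdot k^2 l^2 \cdot 2^{2k+4l} \cdot k^{k} \right)}. \]
   Context: A simplicial complex $X$ on ground set $[n]$ is a downward-closed family of subsets (faces); $X(i)$ denotes the faces of cardinality $i$, and $X(\le d)$ is pure (every face lies in a face of size $d$). Given a probability measure $\Pi_d$ on $X(d)$, the measures $\Pi_i$ on $X(i)$ for $i<d$ are obtained by sampling $\mathfrak s^{(d)}\sim\Pi_d$ and repeatedly deleting a uniformly random element. $C^i$ denotes real functions on $X(i)$ with inner product $\langle f,g\rangle=\mathbb E_{\mathfrak s\sim\Pi_i}[f(\mathfrak s)g(\mathfrak s)]$. For a face $\mathfrak s$ with $|\mathfrak s|\le d-2$, the link is $X_{\mathfrak s}=\{\mathfrak t\setminus\mathfrak s : \mathfrak s\subseteq\mathfrak t\in X\}$ and its skeleton $G(X_{\mathfrak s})$ is the weighted graph with vertex set $X_{\mathfrak s}(1)$, edge set $X_{\mathfrak s}(2)$ and edge weights proportional to $\Pi_{|\mathfrak s|+2}$. $X(\le d)$ is a $\gamma$-HDX if for every $0\le i\le d-2$ and every $\mathfrak s\in X(i)$ the second singular value of the normalized adjacency matrix of $G(X_{\mathfrak s})$ is at most $\gamma$. The swap walk $\mathsf{S}_{k,l}$ from $X(k)$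 to $X(l)$ (for $d\ge k+l$) is the Markov operator: from $\mathfrak s\in X(k)$, move up to $\mathfrak s''\in X(k+l)$ with $\mathfrak s''\supseteq\mathfrak s$, chosen with probability $\frac{1}{\binom{k+l}{l}}\cdot\frac{\Pi_{k+l}(\mathfrak s'')}{\Pi_k(\mathfrak s)}$, then deterministically go to $\mathfrak s''\setminus\mathfrak s\in X(l)$; it acts as an operator $C^l\to C^k$ (inner products w.r.t. $\Pi_l$ and $\Pi_k$). $\sigma_2$ denotes the second largest singular value. *)

theory Defs
  imports
    "HOL-Probability.Probability_Mass_Function"
    "Jordan_Normal_Form.Char_Poly"
begin

section \<open>Singular values\<close>

definition singular_values :: "real mat \<Rightarrow> real multiset" where
  "singular_values A = image_mset sqrt (proots (char_poly (transpose_mat A * A)))"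

text \<open>
  The second largest singular value, counted with multiplicity. There is one singular value per
  column of the matrix; compared with the convention that counts only as many as the smaller
  dimension, this only adds zeros. If there are fewer than two singular values, the result is 0.
\<close>
definition second_singular_value :: "real mat \<Rightarrow> real" where
  "second_singular_value A =
     (let \<sigma>s = rev (sorted_list_of_multiset (singular_values A))
      in if length \<sigma>s \<ge> 2 then \<sigma>s ! 1 else 0)"

text \<open>
  A matrix with rows indexed by the finite set \<open>B\<close> and columns by the finite set \<open>A\<close>. The order
  in which the sets are enumerated does not affect the singular values.
\<close>
definition matrix_on :: "'b set \<Rightarrow> 'a set \<Rightarrow> ('b \<Rightarrow> 'a \<Rightarrow> real) \<Rightarrow> real mat" where
  "matrix_on B A m =
     mat (card B) (card A) (\<lambda>(i, j). m (from_nat_into B i) (from_nat_into A j))"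


section \<open>Weighted simplicial complexes\<close>

definition abstract_simplicial_complex :: "nat \<Rightarrow> nat set set \<Rightarrow> bool" where
  "abstract_simplicial_complex n X \<longleftrightarrow>
     (\<forall>s\<in>X. s \<subseteq> {1..n}) \<and> (\<forall>s\<in>X. \<forall>t. t \<subseteq> s \<longrightarrow> t \<in> X)"

definition faces :: "nat set set \<Rightarrow> nat \<Rightarrow> nat set set" where
  "faces X i = {s \<in> X. card s = i}"

definition faces_upto :: "nat set set \<Rightarrow> nat \<Rightarrow> nat set set" where
  "faces_upto X d = {s \<in> X. card s \<le> d}"

definition pure_upto :: "nat set set \<Rightarrow> nat \<Rightarrow> bool" where
  "pure_upto X d \<longleftrightarrow> (\<forall>s \<in> faces_upto X d. \<exists>t \<in> faces X d. s \<subseteq> t)"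

definition delete_random :: "nat set pmf \<Rightarrow> nat set pmf" where
  "delete_random P = bind_pmf P (\<lambda>s. map_pmf (\<lambda>x. s - {x}) (pmf_of_set s))"

text \<open>The measure on faces of size \<open>i \<le> d\<close> induced by a measure \<open>P\<close> on faces of size \<open>d\<close>.\<close>
definition marginal :: "nat set pmf \<Rightarrow> nat \<Rightarrow> nat \<Rightarrow> nat set pmf" where
  "marginal P d i = (delete_random ^^ (d - i)) P"


section \<open>High-dimensional expanders\<close>

definition link :: "nat set set \<Rightarrow> nat set \<Rightarrow> nat set set" where
  "link X s = {t - s | t. t \<in> X \<and> s \<subseteq> t}"

text \<open>
  The weighted skeleton of the link of \<open>s\<close>. Its vertices are the singletons in the link, so the edge
  between distinct vertices \<open>u\<close> and \<open>v\<close> is \<open>u \<union> v\<close>; for \<open>u = v\<close> this union has size 1 and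
  there is no loop. The weights are left unnormalised, since a common factor cancels in the
  normalised adjacency matrix.
\<close>
definition skeleton_weight ::
    "nat set set \<Rightarrow> nat set pmf \<Rightarrow> nat \<Rightarrow> nat set \<Rightarrow> nat set \<Rightarrow> nat set \<Rightarrow> real" where
  "skeleton_weight X P d s u v =
     (if u \<union> v \<in> faces (link X s) 2 then pmf (marginal P d (card s + 2)) (s \<union> (u \<union> v)) else 0)"

text \<open>
  The normalised adjacency matrix $D^{-1/2} W D^{-1/2}$. Vertices of weighted degree 0 give zero
  rows and columns, as division by zero is zero; they contribute only singular values 0.
\<close>
definition normalized_adjacency :: "'v set \<Rightarrow> ('v \<Rightarrow> 'v \<Rightarrow> real) \<Rightarrow> real mat" where
  "normalized_adjacency V w =
     matrix_on V V (\<lambda>u v. w u v / (sqrt (\<Sum>x\<in>V. w u x) * sqrt (\<Sum>x\<in>V. w v x)))"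

text \<open>
  The measure is not required to charge every face. If the face \<open>s\<close> has measure 0, all edge
  weights in its link vanish, so that the matrix below is 0 and \<open>s\<close> imposes no
  condition beyond \<open>0 \<le> \<gamma>\<close>.
\<close>
definition hdx :: "nat set set \<Rightarrow> nat set pmf \<Rightarrow> nat \<Rightarrow> real \<Rightarrow> bool" where
  "hdx X P d \<gamma> \<longleftrightarrow>
     (\<forall>i. i + 2 \<le> d \<longrightarrow> (\<forall>s \<in> faces X i.
        second_singular_value
          (normalized_adjacency (faces (link X s) 1) (skeleton_weight X P d s)) \<le> \<gamma>))"


section \<open>Swap walks\<close>

definition inner_pmf :: "'a pmf \<Rightarrow> ('a \<Rightarrow> real) \<Rightarrow> ('a \<Rightarrow> real) \<Rightarrow> real" where
  "inner_pmf p f g = measure_pmf.expectation p (\<lambda>s. f s * g s)"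

text \<open>
  The normalised indicator functions of the points of positive mass form an orthonormal basis of
  the functions with the inner product \<open>inner_pmf p\<close> (functions vanishing on the support being
  identified with 0). At a point of mass 0 the function below is 0.
\<close>
definition unit_indicator :: "'a pmf \<Rightarrow> 'a \<Rightarrow> 'a \<Rightarrow> real" where
  "unit_indicator p a = (\<lambda>x. indicator {a} x / sqrt (pmf p a))"

text \<open>
  The matrix, with respect to these orthonormal bases, of an operator from the functions on \<open>A\<close> with
  the measure \<open>p\<close> to the functions on \<open>B\<close> with the measure \<open>q\<close>. Its singular values are those of the
  operator with respect to the two inner products, up to additional zeros
  from points of mass 0.
\<close>
definition operator_matrix ::
    "'a set \<Rightarrow> 'a pmf \<Rightarrow> 'b set \<Rightarrow> 'b pmf \<Rightarrow> (('a \<Rightarrow> real) \<Rightarrow> ('b \<Rightarrow> real)) \<Rightarrow> real mat" where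
  "operator_matrix A p B q T =
     matrix_on B A (\<lambda>b a. inner_pmf q (unit_indicator q b) (T (unit_indicator p a)))"

definition swap_walk ::
    "nat set set \<Rightarrow> nat set pmf \<Rightarrow> nat \<Rightarrow> nat \<Rightarrow> nat \<Rightarrow> (nat set \<Rightarrow> real) \<Rightarrow> (nat set \<Rightarrow> real)" where
  "swap_walk X P d k l f = (\<lambda>s.
     \<Sum>s'' \<in> {s'' \<in> faces X (k + l). s \<subseteq> s''}.
       1 / real ((k + l) choose l) * (pmf (marginal P d (k + l)) s'' / pmf (marginal P d k) s)
         * f (s'' - s))"

definition swap_walk_sigma2 :: "nat set set \<Rightarrow> nat set pmf \<Rightarrow> nat \<Rightarrow> nat \<Rightarrow> nat \<Rightarrow> real" where
  "swap_walk_sigma2 X P d k l =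
     second_singular_value
       (operator_matrix (faces X l) (marginal P d l) (faces X k) (marginal P d k)
          (swap_walk X P d k l))"

end

theory Submission
  imports Defs "Jordan_Normal_Form.Schur_Decomposition"
begin

text \<open>
  The stronger bound $\sigma_2(S_{k,l}) \le kl\gamma$ is shown by localisation, following Dikstein and
  Dinur. An edge $(A, B)$ of the swap walk can be sampled by first choosing a vertex $v$ and then an
  edge with $v \in A$. Conditioned on $v$, it is an edge of $S_{k-1,l}$ in the link of $v$, while the
  pairs $(v, B)$ are the edges of $S_{1,l}$. Splitting a covariance into the part inside
  the links and the part between the conditional means gives
  $\sigma_2(S_{k,l}) \le \max_v \sigma_2(S_{k-1,l}(X_v)) + \sigma_2(S_{1,l})$. In the same way
  $\sigma_2(S_{1,l}) = \sigma_2(S_{l,1}) \le l\gamma$, since $S_{1,1}$ in a link is the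
  random walk on its skeleton.
  Together with $\sigma_2 \le 1$ this implies the claim: $kl\gamma \le kl\sqrt\gamma$ if $\gamma \le 1$.
\<close>

text \<open>The induction carries covariance inequalities (\<open>mixing\<close>) for unnormalised
  joint weights rather than singular values. These inequalities survive scaling, transposition and
  points of weight 0, so every link can be indexed by all subsets of a given size, and faces of
  measure 0 cause no trouble in the conditioning. Singular values occur only at the two ends. From
  covariances to \<open>second_singular_value\<close> the argument is of Courant-Fischer type: one
  linear constraint cannot exclude two large singular values. The way back is more delicate, since a
  bound on the second singular value controls the complement of some top singular vector, whereas a
  covariance concerns the complement of the constants. The two agree if \<mu> < 1: the constants
  have singular value 1, so they must span the only direction with singular value above \<mu>. For
  \<mu> \<ge> 1 the covariance bound is just Cauchy-Schwarz.\<close>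

unbundle no vec_syntax

section \<open>Spectral theorem for real symmetric matrices\<close>

text \<open>Over the complex numbers the characteristic polynomial has a root a. For an eigenvector
  v the form \<open>T\<close> = v* S v equals a |v|^2, and symmetry of the real matrix S makes it
  invariant under conjugation, so a is real.\<close>

lemma real_symmetric_eigenvalue_exists:
  fixes S :: "real mat"
  assumes S: "S \<in> carrier_mat n n" and sym: "transpose_mat S = S" and n: "n \<noteq> 0"
  shows "\<exists>e. eigenvalue S e"
proof -
  define C where "C = map_mat complex_of_real S"
  have C: "C \<in> carrier_mat n n" using S by (simp add: C_def)
  obtain as where as: "char_poly C = (\<Prod> a \<leftarrow> as. [:- a, 1:])" "length as = n"
    using char_poly_factorized[OF C] by blast
  obtain a where "a \<in> set as" using as(2) n by (cases as) auto
  hence root: "poly (char_poly C) a = 0"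
    unfolding as(1) poly_prod_list by (auto simp: prod_list_zero_iff image_iff intro!: bexI[of _ a])
  hence "eigenvalue C a" using eigenvalue_root_char_poly[OF C] by blast
  then obtain v where v: "v \<in> carrier_vec n" "v \<noteq> 0\<^sub>v n" "C *\<^sub>v v = a \<cdot>\<^sub>v v"
    using C unfolding eigenvalue_def eigenvector_def by auto
  have symS: "S $$ (i, j) = S $$ (j, i)" if "i < n" "j < n" for i j
    using that S sym by (metis index_transpose_mat(1) carrier_matD)
  have ev: "(\<Sum>j<n. complex_of_real (S $$ (i, j)) * v $ j) = a * v $ i" if "i < n" for i
  proof -
    have "(C *\<^sub>v v) $ i = (\<Sum>j<n. complex_of_real (S $$ (i, j)) * v $ j)"
      using that S v(1) by (auto simp: C_def scalar_prod_def atLeast0LessThan intro!: sum.cong)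
    thus ?thesis using v that by simp
  qed
  define N where "N = (\<Sum>i<n. (cmod (v $ i))\<^sup>2)"
  define T where "T = (\<Sum>i<n. \<Sum>j<n. cnj (v $ i) * complex_of_real (S $$ (i, j)) * v $ j)"
  have T: "T = a * complex_of_real N"
  proof -
    have "T = (\<Sum>i<n. cnj (v $ i) * (\<Sum>j<n. complex_of_real (S $$ (i, j)) * v $ j))"
      by (simp add: T_def sum_distrib_left mult.assoc)
    also have "\<dots> = (\<Sum>i<n. cnj (v $ i) * (a * v $ i))"
      by (intro sum.cong refl) (simp add: ev)
    also have "\<dots> = a * complex_of_real N"
      unfolding N_def of_real_sum sum_distrib_left
      by (intro sum.cong refl) (simp add: complex_norm_square mult_ac del: of_real_power)
    finally show ?thesis .
  qed
  have "cnj T = (\<Sum>i<n. \<Sum>j<n. v $ i * complex_of_real (S $$ (i, j)) * cnj (v $ j))"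
    by (simp add: T_def)
  also have "\<dots> = (\<Sum>j<n. \<Sum>i<n. v $ i * complex_of_real (S $$ (i, j)) * cnj (v $ j))"
    by (rule sum.swap)
  also have "\<dots> = T" unfolding T_def
    by (intro sum.cong refl) (simp add: symS mult_ac)
  finally have "cnj a * complex_of_real N = a * complex_of_real N" using T by simp
  moreover have "N > 0"
  proof -
    obtain i where "i < n" "v $ i \<noteq> 0" using v(1,2) by (metis carrier_vecD eq_vecI index_zero_vec)
    hence "N \<ge> (cmod (v $ i))\<^sup>2" unfolding N_def by (intro member_le_sum) auto
    with \<open>v $ i \<noteq> 0\<close> show ?thesis by (smt (verit) zero_less_norm_iff zero_less_power)
  qed
  ultimately have "cnj a = a" by simp
  then obtain e where e: "a = complex_of_real e" by (metis Reals_cases Reals_cnj_iff)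
  have "char_poly C = map_poly complex_of_real (char_poly S)"
    unfolding C_def by (rule of_real_hom.char_poly_hom[OF S])
  hence "complex_of_real (poly (char_poly S) e) = 0" using root e by simp
  thus ?thesis using eigenvalue_root_char_poly[OF S] by auto
qed

text \<open>Gram-Schmidt applied to a completion of v to a basis keeps v as its first vector;
  scaling all vectors to length 1 then gives the columns of W.\<close>

lemma orthogonal_mat_extension:
  fixes v :: "real vec"
  assumes v: "v \<in> carrier_vec n" and v0: "v \<noteq> 0\<^sub>v n"
  shows "\<exists>W c. W \<in> carrier_mat n n \<and> transpose_mat W * W = 1\<^sub>m n \<and> col W 0 = c \<cdot>\<^sub>v v"
proof -
  interpret cof_vec_space n "TYPE(real)" .
  define ws where "ws = gram_schmidt n (basis_completion v)"
  note b = basis_completion[OF v v0]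
  have ws: "set ws \<subseteq> carrier_vec n" "corthogonal ws" "length ws = n"
    using gram_schmidt_result[OF b(2,4,5) refl] b(6) by (auto simp: ws_def)
  have n0: "n \<noteq> 0" using v v0 by auto
  obtain vs where "basis_completion v = v # vs"
    using b(6,7) n0 by (cases "basis_completion v") auto
  hence "hd ws = v" unfolding ws_def using gram_schmidt_hd[OF v] by simp
  hence ws0: "ws ! 0 = v" using ws(3) n0 by (metis hd_conv_nth length_0_conv)
  define c where "c w = 1 / sqrt (w \<bullet> w)" for w :: "real vec"
  define us where "us = map (\<lambda>w. c w \<cdot>\<^sub>v w) ws"
  define W where "W = mat_of_cols n us"
  have W: "W \<in> carrier_mat n n" unfolding W_def us_def using ws(3) by (metis length_map mat_of_cols_carrier(1))
  have car: "ws ! i \<in> carrier_vec n" if "i < n" for i using ws that by auto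
  have col: "col W i = c (ws ! i) \<cdot>\<^sub>v ws ! i" if "i < n" for i
    using that ws car by (simp add: W_def us_def)
  have orth: "(ws ! i \<bullet> ws ! j = 0) \<longleftrightarrow> i \<noteq> j" if "i < n" "j < n" for i j
  proof -
    have "conjugate (ws ! j) = ws ! j" by (rule eq_vecI) auto
    thus ?thesis using corthogonalD[OF ws(2), of i j] that ws(3) by simp
  qed
  have "transpose_mat W * W = 1\<^sub>m n"
  proof (rule eq_matI)
    fix i j assume "i < dim_row (1\<^sub>m n :: real mat)" "j < dim_col (1\<^sub>m n :: real mat)"
    hence i: "i < n" and j: "j < n" by auto
    have "(transpose_mat W * W) $$ (i, j) = col W i \<bullet> col W j" using W i j by simp
    also have "\<dots> = c (ws ! i) * c (ws ! j) * (ws ! i \<bullet> ws ! j)"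
      using car[OF i] car[OF j] by (simp add: col i j)
    also have "\<dots> = (if i = j then 1 else 0)"
    proof (cases "i = j")
      case True
      have "ws ! i \<bullet> ws ! i \<noteq> 0" using orth[OF i i] by simp
      moreover have "ws ! i \<bullet> ws ! i \<ge> 0" by (auto simp: scalar_prod_def intro!: sum_nonneg)
      ultimately show ?thesis using True by (simp add: c_def)
    qed (use orth[OF i j] in simp)
    finally show "(transpose_mat W * W) $$ (i, j) = 1\<^sub>m n $$ (i, j)" using i j by simp
  qed (use W in auto)
  moreover have "col W 0 = c v \<cdot>\<^sub>v v" using col[of 0] n0 ws0 by simp
  ultimately show ?thesis using W by blast
qed

text \<open>Deflation: conjugation by an orthogonal matrix whose first column is a multiple of an
  eigenvector clears the rest of the first column, and by symmetry of the first row. The remaining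
  block is symmetric and one size smaller.\<close>

theorem real_symmetric_diagonalization:
  fixes S :: "real mat"
  assumes "S \<in> carrier_mat n n" and "transpose_mat S = S"
  shows "\<exists>U D. U \<in> carrier_mat n n \<and> D \<in> carrier_mat n n \<and> transpose_mat U * U = 1\<^sub>m n \<and>
    diagonal_mat D \<and> S * U = U * D"
  using assms
proof (induction n arbitrary: S)
  case 0
  show ?case by (intro exI[of _ "1\<^sub>m 0"]) (use 0 in \<open>auto simp: diagonal_mat_def\<close>)
next
  case (Suc n)
  note S = Suc.prems(1)
  obtain e where "eigenvalue S e" using real_symmetric_eigenvalue_exists[OF Suc.prems] by auto
  then obtain v where v: "v \<in> carrier_vec (Suc n)" "v \<noteq> 0\<^sub>v (Suc n)" "S *\<^sub>v v = e \<cdot>\<^sub>v v"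
    using S unfolding eigenvalue_def eigenvector_def by auto
  obtain W c where W: "W \<in> carrier_mat (Suc n) (Suc n)" "transpose_mat W * W = 1\<^sub>m (Suc n)"
    and colW: "col W 0 = c \<cdot>\<^sub>v v"
    using orthogonal_mat_extension[OF v(1,2)] by blast
  define Wt where "Wt = transpose_mat W"
  have Wt: "Wt \<in> carrier_mat (Suc n) (Suc n)" using W by (simp add: Wt_def)
  have WtW: "Wt * W = 1\<^sub>m (Suc n)" using W by (simp add: Wt_def)
  have WWt: "W * Wt = 1\<^sub>m (Suc n)" using mat_mult_left_right_inverse[OF Wt W(1) WtW] .
  define A where "A = Wt * (S * W)"
  have A: "A \<in> carrier_mat (Suc n) (Suc n)" using W S Wt by (simp add: A_def)
  have symA: "transpose_mat A = A"
  proof -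
    have "transpose_mat A = transpose_mat (S * W) * W"
      unfolding A_def using transpose_mult[OF Wt, of "S * W" "Suc n"] S W by (simp add: Wt_def)
    also have "\<dots> = Wt * S * W" using transpose_mult[OF S W(1)] Suc.prems(2) by (simp add: Wt_def)
    also have "\<dots> = A" using Wt S W unfolding A_def by simp
    finally show ?thesis .
  qed
  have A0: "A $$ (i, 0) = (if i = 0 then e else 0)" if "i < Suc n" for i
  proof -
    have "A $$ (i, 0) = row Wt i \<bullet> (S *\<^sub>v col W 0)"
      using that S W Wt by (simp add: A_def mult_mat_vec_def col_mult2)
    also have "S *\<^sub>v col W 0 = c \<cdot>\<^sub>v (e \<cdot>\<^sub>v v)" using colW v S by (simp add: mult_mat_vec)
    also have "\<dots> = e \<cdot>\<^sub>v col W 0" using colW by (simp add: smult_smult_assoc mult.commute)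
    also have "row Wt i \<bullet> (e \<cdot>\<^sub>v col W 0) = e * (Wt * W) $$ (i, 0)"
      using that W Wt by simp
    finally show ?thesis using that by (simp add: WtW)
  qed
  have A0': "A $$ (0, i) = (if i = 0 then e else 0)" if "i < Suc n" for i
    using A0[OF that] symA A that by (metis carrier_matD index_transpose_mat(1) zero_less_Suc)
  define B where "B = mat n n (\<lambda>(i, j). A $$ (Suc i, Suc j))"
  have B: "B \<in> carrier_mat n n" by (simp add: B_def)
  have Ablock: "A = four_block_mat (mat 1 1 (\<lambda>_. e)) (0\<^sub>m 1 n) (0\<^sub>m n 1) B"
    by (rule eq_matI) (use A A0 A0' in \<open>auto simp: B_def\<close>)
  have "transpose_mat B = B"
  proof (rule eq_matI)
    fix i j assume "i < dim_row B" "j < dim_col B"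
    hence "Suc i < Suc n" "Suc j < Suc n" by (auto simp: B_def)
    moreover from this have "A $$ (Suc j, Suc i) = A $$ (Suc i, Suc j)"
      using symA A by (metis carrier_matD index_transpose_mat(1))
    ultimately show "transpose_mat B $$ (i, j) = B $$ (i, j)" by (simp add: B_def)
  qed (use B in auto)
  from Suc.IH[OF B this] obtain U D where U: "U \<in> carrier_mat n n" and D: "D \<in> carrier_mat n n"
    and UU: "transpose_mat U * U = 1\<^sub>m n" and diag: "diagonal_mat D" and BU: "B * U = U * D"
    by blast
  define U1 where "U1 = four_block_mat (1\<^sub>m 1) (0\<^sub>m 1 n) (0\<^sub>m n 1) U"
  define D1 where "D1 = four_block_mat (mat 1 1 (\<lambda>_. e)) (0\<^sub>m 1 n) (0\<^sub>m n 1) D"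
  have E: "mat 1 1 (\<lambda>_. e) \<in> carrier_mat 1 1" by simp
  have U1: "U1 \<in> carrier_mat (Suc n) (Suc n)" and D1: "D1 \<in> carrier_mat (Suc n) (Suc n)"
    using U D by (auto simp: U1_def D1_def)
  have UU1: "transpose_mat U1 * U1 = 1\<^sub>m (Suc n)"
  proof -
    have "transpose_mat U1 = four_block_mat (1\<^sub>m 1) (0\<^sub>m 1 n) (0\<^sub>m n 1) (transpose_mat U)"
      unfolding U1_def
      using transpose_four_block_mat[OF one_carrier_mat zero_carrier_mat zero_carrier_mat U, of 1]
      by simp
    hence "transpose_mat U1 * U1 = four_block_mat (1\<^sub>m 1) (0\<^sub>m 1 n) (0\<^sub>m n 1) (1\<^sub>m n)"
      unfolding U1_def using U UU by (simp add: mult_four_block_mat[of _ 1 1 _ n _ n _ _ 1 _ n])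
    thus ?thesis by simp
  qed
  have AU1: "A * U1 = U1 * D1"
    unfolding U1_def D1_def Ablock using U D B BU E
    by (simp add: mult_four_block_mat[of _ 1 1 _ n _ n _ _ 1 _ n])
  have "diagonal_mat D1"
    using diag D unfolding diagonal_mat_def D1_def by auto
  moreover have "S * (W * U1) = (W * U1) * D1"
  proof -
    have "W * A = (W * Wt) * (S * W)" unfolding A_def
      using assoc_mult_mat[OF W(1) Wt, of "S * W" "Suc n"] S W(1) by simp
    hence WA: "W * A = S * W" using WWt S W by simp
    have "S * (W * U1) = W * A * U1" using S W U1 WA by simp
    also have "\<dots> = W * (A * U1)" using W A U1 by simp
    also have "\<dots> = (W * U1) * D1" unfolding AU1 using W U1 D1 by simp
    finally show ?thesis .
  qed
  moreover have "transpose_mat (W * U1) * (W * U1) = 1\<^sub>m (Suc n)"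
  proof -
    have "transpose_mat (W * U1) * (W * U1) = transpose_mat U1 * Wt * (W * U1)"
      using transpose_mult[OF W(1) U1] by (simp add: Wt_def)
    also have "\<dots> = transpose_mat U1 * (Wt * W * U1)"
      using assoc_mult_mat[of "transpose_mat U1" "Suc n" "Suc n" Wt "Suc n" "W * U1" "Suc n"]
        assoc_mult_mat[OF Wt W(1) U1] W(1) U1 Wt by simp
    finally have "transpose_mat (W * U1) * (W * U1) = transpose_mat U1 * (Wt * W * U1)" .
    thus ?thesis using UU1 WtW U1 by simp
  qed
  ultimately show ?case using W U1 D1 by (intro exI[of _ "W * U1"] exI[of _ D1]) auto
qed

section \<open>Singular value decomposition in coordinates\<close>

lemma sum_orthogonal_columns:
  fixes a :: "nat \<Rightarrow> nat \<Rightarrow> real"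
  assumes "\<And>i j. i < n \<Longrightarrow> j < n \<Longrightarrow> (\<Sum>k<m. a k i * a k j) = (if i = j then e i else 0)"
  shows "(\<Sum>k<m. (\<Sum>i<n. a k i * c i) * (\<Sum>j<n. a k j * d j)) = (\<Sum>i<n. e i * c i * d i)"
proof -
  have "(\<Sum>k<m. (\<Sum>i<n. a k i * c i) * (\<Sum>j<n. a k j * d j)) =
      (\<Sum>k<m. \<Sum>i<n. \<Sum>j<n. c i * d j * (a k i * a k j))"
    by (simp add: sum_product mult_ac)
  also have "\<dots> = (\<Sum>i<n. \<Sum>k<m. \<Sum>j<n. c i * d j * (a k i * a k j))"
    by (rule sum.swap)
  also have "\<dots> = (\<Sum>i<n. \<Sum>j<n. \<Sum>k<m. c i * d j * (a k i * a k j))"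
    by (intro sum.cong refl sum.swap)
  also have "\<dots> = (\<Sum>i<n. \<Sum>j<n. c i * d j * (if i = j then e i else 0))"
    by (intro sum.cong refl) (simp add: assms sum_distrib_left[symmetric])
  also have "\<dots> = (\<Sum>i<n. e i * c i * d i)"
    by (intro sum.cong refl) (simp add: if_distrib sum.delta cong: if_cong)
  finally show ?thesis .
qed

text \<open>The vectors \<open>v i\<close> are the right singular vectors, i.e. an orthonormal
  eigenbasis of the Gram matrix of M, and \<open>e i\<close> are its eigenvalues. This is the
  interface through which roots of a characteristic polynomial become statements about quadratic
  forms.\<close>

lemma singular_value_expansion:
  fixes M :: "real mat"
  assumes M: "M \<in> carrier_mat m n"
  obtains v e where
    "singular_values M = image_mset (\<lambda>i. sqrt (e i)) (mset_set {..<n})"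
    and "\<And>i. i < n \<Longrightarrow> e i \<ge> 0"
    and "\<And>i j. i < n \<Longrightarrow> j < n \<Longrightarrow> (\<Sum>k<n. v i k * v j k) = (if i = j then 1 else 0)"
    and "\<And>f g. (\<Sum>j<n. f j * g j) = (\<Sum>i<n. (\<Sum>j<n. v i j * f j) * (\<Sum>j<n. v i j * g j))"
    and "\<And>f. (\<Sum>k<m. (\<Sum>j<n. M $$ (k, j) * f j)\<^sup>2) = (\<Sum>i<n. e i * (\<Sum>j<n. v i j * f j)\<^sup>2)"
proof -
  define S where "S = transpose_mat M * M"
  have S: "S \<in> carrier_mat n n" using M by (simp add: S_def)
  have "transpose_mat S = S" unfolding S_def using M by (simp add: transpose_mult[of _ n m _ n])
  from real_symmetric_diagonalization[OF S this] obtain U D where U: "U \<in> carrier_mat n n"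
    and D: "D \<in> carrier_mat n n" and UU: "transpose_mat U * U = 1\<^sub>m n"
    and diag: "diagonal_mat D" and SU: "S * U = U * D" by blast
  define e where "e i = D $$ (i, i)" for i
  define v where "v i j = U $$ (j, i)" for i j
  have Ut: "transpose_mat U \<in> carrier_mat n n" using U by simp
  have UUt: "U * transpose_mat U = 1\<^sub>m n" using mat_mult_left_right_inverse[OF Ut U UU] .
  have ortho: "(\<Sum>k<n. v i k * v j k) = (if i = j then 1 else 0)" if "i < n" "j < n" for i j
  proof -
    have "(transpose_mat U * U) $$ (i, j) = (\<Sum>k<n. v i k * v j k)"
      using that U by (simp add: scalar_prod_def v_def atLeast0LessThan)
    thus ?thesis using that UU by simp
  qed
  have complete: "(\<Sum>i<n. v i k * v i l) = (if k = l then 1 else 0)" if "k < n" "l < n" for k l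
  proof -
    have "(U * transpose_mat U) $$ (k, l) = (\<Sum>i<n. v i k * v i l)"
      using that U by (simp add: scalar_prod_def v_def atLeast0LessThan)
    thus ?thesis using that UUt by simp
  qed
  \<comment> \<open>Here the orthonormal columns summed over are those of the array
    \<open>v i k\<close>, which are the rows of U; hence \<open>complete\<close> and not
    \<open>ortho\<close>.\<close>
  have parseval: "(\<Sum>j<n. f j * g j) = (\<Sum>i<n. (\<Sum>j<n. v i j * f j) * (\<Sum>j<n. v i j * g j))" for f g
    using sum_orthogonal_columns[where a = v and n = n and m = n and e = "\<lambda>_. 1" and c = f and d = g] complete by simp
  define N where "N = M * U"
  have N: "N \<in> carrier_mat m n" using M U by (simp add: N_def)
  have NN: "transpose_mat N * N = D"
  proof -
    have "transpose_mat N * N = transpose_mat U * (S * U)"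
      unfolding S_def N_def using M U
        assoc_mult_mat[of "transpose_mat U" n n "transpose_mat M" m "M * U" n]
        assoc_mult_mat[of "transpose_mat M" n m M n U n]
      by (simp add: transpose_mult[of _ m n _ n])
    also have "\<dots> = transpose_mat U * U * D" unfolding SU using U D by simp
    finally show ?thesis using UU D by simp
  qed
  \<comment> \<open>The Gram matrix of the columns of \<open>N\<close> is D. So these columns are
    orthogonal with squared lengths \<open>e i\<close>, which also shows that \<open>e i\<close> is
    nonnegative.\<close>
  have quad: "(\<Sum>k<m. N $$ (k, i) * N $$ (k, j)) = (if i = j then e i else 0)"
    if "i < n" "j < n" for i j
  proof -
    have "(transpose_mat N * N) $$ (i, j) =
        (\<Sum>k<m. N $$ (k, i) * N $$ (k, j))"
      using that N by (simp add: scalar_prod_def atLeast0LessThan)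
    thus ?thesis using that D diag NN unfolding diagonal_mat_def e_def by auto
  qed
  have coeff: "(\<Sum>j<n. M $$ (k, j) * f j) = (\<Sum>i<n. N $$ (k, i) * (\<Sum>j<n. v i j * f j))"
    if "k < m" for k f
  proof -
    have "(\<Sum>i<n. N $$ (k, i) * (\<Sum>j<n. v i j * f j)) =
        (\<Sum>i<n. (\<Sum>j<n. v i j * M $$ (k, j)) * (\<Sum>j<n. v i j * f j))"
      using that M U by (intro sum.cong refl) (simp add: N_def scalar_prod_def v_def atLeast0LessThan mult.commute)
    thus ?thesis using parseval[of "\<lambda>j. M $$ (k, j)" f] by simp
  qed
  have expand: "(\<Sum>k<m. (\<Sum>j<n. M $$ (k, j) * f j)\<^sup>2) = (\<Sum>i<n. e i * (\<Sum>j<n. v i j * f j)\<^sup>2)" for f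
    using sum_orthogonal_columns[where a = "\<lambda>k i. N $$ (k, i)" and n = n and m = m and e = e
        and c = "\<lambda>i. \<Sum>j<n. v i j * f j" and d = "\<lambda>i. \<Sum>j<n. v i j * f j"] quad
    by (simp add: coeff power2_eq_square mult.assoc)
  have "e i \<ge> 0" if "i < n" for i
    using quad[OF that that] by (metis (no_types, lifting) sum_nonneg zero_le_square)
  moreover have "singular_values M = image_mset (\<lambda>i. sqrt (e i)) (mset_set {..<n})"
  proof -
    have "S = U * D * transpose_mat U"
    proof -
      have "S = S * (U * transpose_mat U)" unfolding UUt using S by simp
      also have "\<dots> = S * U * transpose_mat U" using S U Ut by (simp add: assoc_mult_mat)
      finally show ?thesis unfolding SU .
    qed
    hence "similar_mat S D"
      unfolding similar_mat_def using similar_mat_witI[OF UUt UU _ S D U Ut] by blast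
    hence "char_poly S = char_poly D" by (rule char_poly_similar)
    also have "\<dots> = (\<Prod>a\<leftarrow>diag_mat D. [:- a, 1:])"
      by (rule char_poly_upper_triangular[OF D]) (use diag in \<open>auto simp: diagonal_mat_def upper_triangular_def\<close>, use D in auto)
    finally have cp: "char_poly S = (\<Prod>a\<leftarrow>diag_mat D. [:- a, 1:])" .
    have "proots (\<Prod>a\<leftarrow>xs. [:- a, 1:]) = mset xs" for xs :: "real list"
    proof (induction xs)
      case (Cons x xs)
      have "(\<Prod>a\<leftarrow>xs. [:- a, 1:]) \<noteq> 0" by (auto simp: prod_list_zero_iff)
      hence "proots ([:- x, 1:] * (\<Prod>a\<leftarrow>xs. [:- a, 1:])) = {#x#} + mset xs"
        using Cons by (subst proots_mult) auto
      thus ?case by simp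
    qed simp
    hence "proots (char_poly S) = mset (map e [0..<n])"
      using D by (simp only: cp diag_mat_def carrier_matD e_def[abs_def])
    thus ?thesis unfolding singular_values_def S_def[symmetric]
      by (simp add: multiset.map_comp comp_def atLeast0LessThan)
  qed
  ultimately show ?thesis using that ortho parseval expand by blast
qed

section \<open>The second singular value\<close>

text \<open>In a decreasing list the second entry exceeds \<mu> exactly if at least two entries do.
  Nonnegativity of \<mu> matches the default value 0 for lists that are too short.\<close>

lemma second_largest_le_iff:
  fixes A :: "real multiset"
  assumes "\<mu> \<ge> 0"
  defines "L \<equiv> rev (sorted_list_of_multiset A)"
  shows "(if length L \<ge> 2 then L ! 1 else 0) \<le> \<mu> \<longleftrightarrow> size (filter_mset (\<lambda>x. x > \<mu>) A) \<le> 1"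
proof -
  have A: "A = mset L" by (simp add: L_def)
  have sorted: "sorted_wrt (\<ge>) L" unfolding L_def sorted_wrt_rev by simp
  consider "L = []" | x where "L = [x]" | x y r where "L = x # y # r"
    by (metis list.exhaust)
  thus ?thesis
  proof cases
    case (3 x y r)
    have "filter (\<lambda>z. z > \<mu>) r = []" if "y \<le> \<mu>"
      using that sorted 3 by (auto simp: filter_empty_conv)
    moreover have "y \<le> x" using sorted 3 by simp
    ultimately show ?thesis unfolding A 3 by (auto simp flip: mset_filter)
  qed (use assms(1) in \<open>auto simp: A simp flip: mset_filter\<close>)
qed

lemma second_singular_value_le_iff:
  fixes n :: nat
  assumes "\<mu> \<ge> 0" and "singular_values M = image_mset s (mset_set {..<n})"
  shows "second_singular_value M \<le> \<mu> \<longleftrightarrow> card {i. i < n \<and> s i > \<mu>} \<le> 1"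
proof -
  have "size (filter_mset (\<lambda>x. x > \<mu>) (singular_values M)) = card {i. i < n \<and> s i > \<mu>}"
    unfolding assms(2) by (simp add: filter_mset_image_mset filter_mset_mset_set)
  thus ?thesis using second_largest_le_iff[OF assms(1), of "singular_values M"]
    unfolding second_singular_value_def Let_def by simp
qed

lemma second_singular_value_nonneg: "second_singular_value M \<ge> 0"
proof -
  obtain e where sv: "singular_values M = image_mset (\<lambda>i. sqrt (e i)) (mset_set {..<dim_col M})"
    and e: "\<And>i. i < dim_col M \<Longrightarrow> e i \<ge> (0 :: real)"
    by (rule singular_value_expansion[OF carrier_matI[OF refl refl]]) (rule that)
  define L where "L = rev (sorted_list_of_multiset (singular_values M))"
  have "set L = set_mset (singular_values M)" by (simp add: L_def)
  hence "\<forall>x\<in>set L. x \<ge> 0" using sv e by auto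
  moreover have "L ! 1 \<in> set L" if "length L \<ge> 2" using that by auto
  ultimately show ?thesis unfolding second_singular_value_def Let_def L_def[symmetric] by auto
qed

text \<open>If two singular values exceeded \<mu>, the plane spanned by their singular vectors would
  contain a nonzero vector orthogonal to u, which M would stretch by a factor larger than
  \<mu>.\<close>

lemma second_singular_value_leI:
  fixes M :: "real mat"
  assumes M: "M \<in> carrier_mat m n" and "\<mu> \<ge> 0"
    and contract: "\<And>f. (\<Sum>j<n. u j * f j) = 0 \<Longrightarrow>
      (\<Sum>k<m. (\<Sum>j<n. M $$ (k, j) * f j)\<^sup>2) \<le> \<mu>\<^sup>2 * (\<Sum>j<n. (f j)\<^sup>2)"
  shows "second_singular_value M \<le> \<mu>"
proof (rule ccontr)
  assume gt: "\<not> second_singular_value M \<le> \<mu>"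
  obtain v e where sv: "singular_values M = image_mset (\<lambda>i. sqrt (e i)) (mset_set {..<n})"
    and e: "\<And>i. i < n \<Longrightarrow> e i \<ge> 0"
    and ortho: "\<And>i j. i < n \<Longrightarrow> j < n \<Longrightarrow> (\<Sum>k<n. v i k * v j k) = (if i = j then 1 else 0)"
    and parseval: "\<And>f g. (\<Sum>j<n. f j * g j) =
      (\<Sum>i<n. (\<Sum>j<n. v i j * f j) * (\<Sum>j<n. v i j * g j))"
    and expand: "\<And>f. (\<Sum>k<m. (\<Sum>j<n. M $$ (k, j) * f j)\<^sup>2) = (\<Sum>i<n. e i * (\<Sum>j<n. v i j * f j)\<^sup>2)"
    by (rule singular_value_expansion[OF M]) (rule that)
  define I where "I = {i. i < n \<and> sqrt (e i) > \<mu>}"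
  have "\<not> card I \<le> 1"
    using gt second_singular_value_le_iff[OF assms(2) sv] by (simp add: I_def)
  then obtain p q where pq: "p \<in> I" "q \<in> I" "p \<noteq> q"
    by (metis One_nat_def card_le_Suc0_iff_eq card.infinite le0)
  hence p: "p < n" and q: "q < n" and ep: "e p > \<mu>\<^sup>2" and eq: "e q > \<mu>\<^sup>2"
    using assms(2) by (auto simp: I_def) (meson not_le real_le_lsqrt real_sqrt_gt_0_iff real_sqrt_le_iff sqrt_le_D)+
  define c where "c i = (\<Sum>j<n. u j * v i j)" for i
  \<comment> \<open>A nontrivial solution of one homogeneous equation in two unknowns; it makes the
    combination \<open>f\<close> below orthogonal to u.\<close>
  obtain \<alpha> \<beta> :: real where ab: "\<alpha> * c p + \<beta> * c q = 0" "\<alpha> \<noteq> 0 \<or> \<beta> \<noteq> 0"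
  proof (cases "c p = 0")
    case True
    show ?thesis by (rule that[of 1 0]) (use True in auto)
  next
    case False
    show ?thesis by (rule that[of "- c q" "c p"]) (use False in auto)
  qed
  define f where "f j = \<alpha> * v p j + \<beta> * v q j" for j
  define d where "d i = (\<Sum>j<n. v i j * f j)" for i
  have "(\<Sum>j<n. u j * f j) = \<alpha> * c p + \<beta> * c q"
    by (simp add: f_def c_def sum_distrib_left sum.distrib distrib_left mult_ac)
  hence "(\<Sum>j<n. u j * f j) = 0" using ab by simp
  from contract[OF this] have le: "(\<Sum>i<n. e i * (d i)\<^sup>2) \<le> \<mu>\<^sup>2 * (\<Sum>i<n. (d i)\<^sup>2)"
    using expand parseval[of f f] by (simp add: d_def power2_eq_square)
  have "d i = \<alpha> * (\<Sum>k<n. v i k * v p k) + \<beta> * (\<Sum>k<n. v i k * v q k)" for i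
    by (simp add: d_def f_def sum_distrib_left sum.distrib distrib_left mult_ac)
  hence d: "d i = (if i = p then \<alpha> else if i = q then \<beta> else 0)" if "i < n" for i
    using that p q pq(3) ortho by simp
  have sum_d: "(\<Sum>i<n. w i * (d i)\<^sup>2) = w p * \<alpha>\<^sup>2 + w q * \<beta>\<^sup>2" for w :: "nat \<Rightarrow> real"
  proof -
    have "(\<Sum>i<n. w i * (d i)\<^sup>2) = (\<Sum>i\<in>{p, q}. w i * (d i)\<^sup>2)"
      by (rule sum.mono_neutral_right) (use p q d in auto)
    thus ?thesis using d p q pq(3) by simp
  qed
  have "e p * \<alpha>\<^sup>2 + e q * \<beta>\<^sup>2 \<le> \<mu>\<^sup>2 * \<alpha>\<^sup>2 + \<mu>\<^sup>2 * \<beta>\<^sup>2"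
    using le sum_d[of e] sum_d[of "\<lambda>_. 1"] by (simp add: distrib_left)
  moreover have "e p * \<alpha>\<^sup>2 \<ge> \<mu>\<^sup>2 * \<alpha>\<^sup>2" "e q * \<beta>\<^sup>2 \<ge> \<mu>\<^sup>2 * \<beta>\<^sup>2"
    using ep eq by (auto intro!: mult_right_mono)
  moreover have "e p * \<alpha>\<^sup>2 > \<mu>\<^sup>2 * \<alpha>\<^sup>2 \<or> e q * \<beta>\<^sup>2 > \<mu>\<^sup>2 * \<beta>\<^sup>2"
    using ep eq ab(2) by (auto intro!: mult_strict_right_mono)
  ultimately show False by linarith
qed

text \<open>M stretches no vector, while it preserves the length of u, so u lies in the span of the
  singular vectors of value 1. As \<mu> < 1 and at most one singular value exceeds \<mu>, u is a
  multiple of a single singular vector. A vector f orthogonal to u has no component there, and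
  elsewhere M contracts by \<mu>.\<close>

lemma second_singular_value_leD:
  fixes M :: "real mat"
  assumes M: "M \<in> carrier_mat m n" and l: "0 \<le> \<mu>" "\<mu> < 1"
    and "second_singular_value M \<le> \<mu>"
    and norm: "\<And>f. (\<Sum>k<m. (\<Sum>j<n. M $$ (k, j) * f j)\<^sup>2) \<le> (\<Sum>j<n. (f j)\<^sup>2)"
    and top: "(\<Sum>k<m. (\<Sum>j<n. M $$ (k, j) * u j)\<^sup>2) = (\<Sum>j<n. (u j)\<^sup>2)"
    and u: "(\<Sum>j<n. (u j)\<^sup>2) \<noteq> 0"
    and f: "(\<Sum>j<n. u j * f j) = 0"
  shows "(\<Sum>k<m. (\<Sum>j<n. M $$ (k, j) * f j)\<^sup>2) \<le> \<mu>\<^sup>2 * (\<Sum>j<n. (f j)\<^sup>2)"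
proof -
  obtain v e where sv: "singular_values M = image_mset (\<lambda>i. sqrt (e i)) (mset_set {..<n})"
    and e: "\<And>i. i < n \<Longrightarrow> e i \<ge> 0"
    and ortho: "\<And>i j. i < n \<Longrightarrow> j < n \<Longrightarrow> (\<Sum>k<n. v i k * v j k) = (if i = j then 1 else 0)"
    and parseval: "\<And>f g. (\<Sum>j<n. f j * g j) =
      (\<Sum>i<n. (\<Sum>j<n. v i j * f j) * (\<Sum>j<n. v i j * g j))"
    and expand: "\<And>f. (\<Sum>k<m. (\<Sum>j<n. M $$ (k, j) * f j)\<^sup>2) = (\<Sum>i<n. e i * (\<Sum>j<n. v i j * f j)\<^sup>2)"
    by (rule singular_value_expansion[OF M]) (rule that)
  define c where "c f i = (\<Sum>j<n. v i j * f j)" for f :: "nat \<Rightarrow> real" and i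
  have sq: "(\<Sum>j<n. (f j)\<^sup>2) = (\<Sum>i<n. (c f i)\<^sup>2)" for f
    using parseval[of f f] by (simp add: c_def power2_eq_square)
  have e1: "e i \<le> 1" if "i < n" for i
  proof -
    have c: "(c (v i) k)\<^sup>2 = (if k = i then 1 else 0)" if "k < n" for k
      using ortho that \<open>i < n\<close> by (simp add: c_def)
    \<comment> \<open>The contraction hypothesis is tested at the singular vector \<open>v i\<close>
      itself.\<close>
    have "(\<Sum>k<n. e k * (c (v i) k)\<^sup>2) \<le> (\<Sum>k<n. (c (v i) k)\<^sup>2)"
      using norm[of "v i"] sq[of "v i"] expand[of "v i"] by (simp add: c_def)
    thus ?thesis using that by (simp add: c if_distrib sum.delta cong: if_cong)
  qed
  \<comment> \<open>Equality of the norms of u and M u, a sum of nonnegative terms, so it holds in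
    each coordinate.\<close>
  have "(\<Sum>i<n. (1 - e i) * (c u i)\<^sup>2) = 0"
    using top sq[of u] expand[of u] by (simp add: c_def left_diff_distrib sum_subtractf)
  hence all0: "\<forall>i\<in>{..<n}. (1 - e i) * (c u i)\<^sup>2 = 0"
    by (subst (asm) sum_nonneg_eq_0_iff) (use e1 in auto)
  have cu: "c u i = 0" if "i < n" "e i < 1" for i
  proof -
    have "(1 - e i) * (c u i)\<^sup>2 = 0" using all0 that(1) by (metis lessThan_iff)
    thus ?thesis using that(2) by simp
  qed
  define I where "I = {i. i < n \<and> sqrt (e i) > \<mu>}"
  have "card I \<le> 1" using assms(4) second_singular_value_le_iff[OF l(1) sv] by (simp add: I_def)
  have small: "e i \<le> \<mu>\<^sup>2" if "i < n" "i \<notin> I" for i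
    using that by (auto simp: I_def not_less sqrt_le_D)
  have cf: "c f i = 0" if i: "i \<in> I" for i
  proof -
    have "k \<notin> I" if "k < n" "k \<noteq> i" for k
      using \<open>card I \<le> 1\<close> i that card_le_Suc0_iff_eq[of I] by (auto simp: I_def)
    moreover have "\<mu>\<^sup>2 < 1" using l by (simp add: power_less_one_iff abs_square_less_1)
    ultimately have other: "c u k = 0" if "k < n" "k \<noteq> i" for k
      using that small cu by (meson order.strict_trans1)
    have "i < n" using i by (simp add: I_def)
    have "(\<Sum>k<n. g k * c u k) = g i * c u i" for g
    proof -
      have "(\<Sum>k<n. g k * c u k) = (\<Sum>k\<in>{i}. g k * c u k)"
        by (rule sum.mono_neutral_right) (use \<open>i < n\<close> other in auto)
      thus ?thesis by simp
    qed
    from this[of "c f"] this[of "c u"] have "c f i * c u i = 0" "c u i * c u i \<noteq> 0"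
      using f u sq[of u] parseval[of f u] by (simp_all add: c_def power2_eq_square mult.commute)
    thus ?thesis by simp
  qed
  have "(\<Sum>i<n. e i * (c f i)\<^sup>2) \<le> (\<Sum>i<n. \<mu>\<^sup>2 * (c f i)\<^sup>2)"
  proof (rule sum_mono)
    fix i assume "i \<in> {..<n}"
    thus "e i * (c f i)\<^sup>2 \<le> \<mu>\<^sup>2 * (c f i)\<^sup>2"
      using small cf by (cases "i \<in> I") (auto intro!: mult_right_mono)
  qed
  thus ?thesis using expand[of f] sq[of f] by (simp add: c_def sum_distrib_left)
qed

section \<open>Covariance bounds for weighted bipartite graphs\<close>

definition weighted_sum :: "'a set \<Rightarrow> 'b set \<Rightarrow> ('a \<Rightarrow> 'b \<Rightarrow> real) \<Rightarrow> ('a \<Rightarrow> 'b \<Rightarrow> real) \<Rightarrow> real" where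
  "weighted_sum A B p h = (\<Sum>x\<in>A. \<Sum>y\<in>B. p x y * h x y)"

text \<open>
  Up to normalisation, the left-hand side is the covariance of \<open>f\<close> and \<open>g\<close> under the joint weights \<open>p\<close>.
  If nonnegative weights have total 0, the quotient is 0, but then so are all the sums.
\<close>
definition mixing :: "real \<Rightarrow> 'a set \<Rightarrow> 'b set \<Rightarrow> ('a \<Rightarrow> 'b \<Rightarrow> real) \<Rightarrow> bool" where
  "mixing \<mu> A B p \<longleftrightarrow> (\<forall>f g.
     \<bar>weighted_sum A B p (\<lambda>x y. f x * g y) -
      weighted_sum A B p (\<lambda>x y. f x) * weighted_sum A B p (\<lambda>x y. g y) / weighted_sum A B p (\<lambda>x y. 1)\<bar>
     \<le> \<mu> * (sqrt (weighted_sum A B p (\<lambda>x y. (f x)\<^sup>2)) * sqrt (weighted_sum A B p (\<lambda>x y. (g y)\<^sup>2))))"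

lemma mixingD:
  assumes "mixing \<mu> A B p"
  shows "\<bar>weighted_sum A B p (\<lambda>x y. f x * g y) -
      weighted_sum A B p (\<lambda>x y. f x) * weighted_sum A B p (\<lambda>x y. g y) / weighted_sum A B p (\<lambda>x y. 1)\<bar>
     \<le> \<mu> * (sqrt (weighted_sum A B p (\<lambda>x y. (f x)\<^sup>2)) * sqrt (weighted_sum A B p (\<lambda>x y. (g y)\<^sup>2)))"
  using assms unfolding mixing_def by blast

lemma weighted_sum_add:
  "weighted_sum A B p (\<lambda>x y. h x y + k x y) = weighted_sum A B p h + weighted_sum A B p k"
  by (simp add: weighted_sum_def distrib_left sum.distrib)

lemma weighted_sum_diff:
  "weighted_sum A B p (\<lambda>x y. h x y - k x y) = weighted_sum A B p h - weighted_sum A B p k"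
  by (simp add: weighted_sum_def right_diff_distrib sum_subtractf)

lemma weighted_sum_cmult:
  "weighted_sum A B p (\<lambda>x y. c * h x y) = c * weighted_sum A B p h"
  by (simp add: weighted_sum_def sum_distrib_left mult_ac)

lemma weighted_sum_swap:
  "weighted_sum A B p h = weighted_sum B A (\<lambda>y x. p x y) (\<lambda>y x. h x y)"
  unfolding weighted_sum_def by (rule sum.swap)

lemma weighted_sum_left:
  "weighted_sum A B p (\<lambda>x y. f x) = (\<Sum>x\<in>A. (\<Sum>y\<in>B. p x y) * f x)"
  by (simp add: weighted_sum_def sum_distrib_right)

lemma weighted_sum_right:
  "weighted_sum A B p (\<lambda>x y. g y) = (\<Sum>y\<in>B. (\<Sum>x\<in>A. p x y) * g y)"
  by (subst weighted_sum_swap) (simp add: weighted_sum_left)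

lemma weighted_sum_nonneg:
  assumes "\<And>x y. x \<in> A \<Longrightarrow> y \<in> B \<Longrightarrow> 0 \<le> p x y"
    and "\<And>x y. x \<in> A \<Longrightarrow> y \<in> B \<Longrightarrow> 0 \<le> h x y"
  shows "0 \<le> weighted_sum A B p h"
  unfolding weighted_sum_def using assms by (auto intro!: sum_nonneg)

lemma sum_mult_le_sqrt:
  fixes a b :: "'a \<Rightarrow> real"
  shows "\<bar>\<Sum>x\<in>A. a x * b x\<bar> \<le> sqrt (\<Sum>x\<in>A. (a x)\<^sup>2) * sqrt (\<Sum>x\<in>A. (b x)\<^sup>2)"
proof -
  have "\<bar>\<Sum>x\<in>A. a x * b x\<bar> \<le> (\<Sum>x\<in>A. \<bar>a x\<bar> * \<bar>b x\<bar>)"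
    by (rule order.trans[OF sum_abs]) (simp add: abs_mult)
  also have "\<dots> \<le> L2_set a A * L2_set b A" by (rule L2_set_mult_ineq)
  finally show ?thesis by (simp add: L2_set_def)
qed

lemma weighted_sum_Cauchy_Schwarz:
  assumes p: "\<And>x y. x \<in> A \<Longrightarrow> y \<in> B \<Longrightarrow> 0 \<le> p x y"
  shows "\<bar>weighted_sum A B p (\<lambda>x y. h x y * k x y)\<bar>
    \<le> sqrt (weighted_sum A B p (\<lambda>x y. (h x y)\<^sup>2)) * sqrt (weighted_sum A B p (\<lambda>x y. (k x y)\<^sup>2))"
proof -
  have eq: "weighted_sum A B p (\<lambda>x y. h x y * k x y) =
      (\<Sum>(x, y)\<in>A \<times> B. (sqrt (p x y) * h x y) * (sqrt (p x y) * k x y))" for h k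
    unfolding weighted_sum_def sum.cartesian_product
  proof (intro sum.cong refl, clarify)
    fix x y assume "x \<in> A" "y \<in> B"
    have "sqrt (p x y) * h x y * (sqrt (p x y) * k x y) = (sqrt (p x y) * sqrt (p x y)) * (h x y * k x y)"
      by (simp only: mult_ac)
    thus "p x y * (h x y * k x y) = sqrt (p x y) * h x y * (sqrt (p x y) * k x y)"
      using p[OF \<open>x \<in> A\<close> \<open>y \<in> B\<close>] by simp
  qed
  show ?thesis
    using sum_mult_le_sqrt[where A = "A \<times> B" and a = "\<lambda>(x, y). sqrt (p x y) * h x y"
        and b = "\<lambda>(x, y). sqrt (p x y) * k x y"]
    unfolding eq power2_eq_square by (simp add: case_prod_unfold)
qed

text \<open>Cauchy-Schwarz against the constant 1: Jensen's inequality for squares without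
  normalisation.\<close>

lemma weighted_sum_square_le:
  assumes "\<And>x y. x \<in> A \<Longrightarrow> y \<in> B \<Longrightarrow> 0 \<le> p x y"
  shows "(weighted_sum A B p h)\<^sup>2 \<le> weighted_sum A B p (\<lambda>x y. (h x y)\<^sup>2) * weighted_sum A B p (\<lambda>x y. 1)"
proof -
  have "\<bar>weighted_sum A B p h\<bar>
      \<le> sqrt (weighted_sum A B p (\<lambda>x y. (h x y)\<^sup>2) * weighted_sum A B p (\<lambda>x y. 1))"
    using weighted_sum_Cauchy_Schwarz[of A B p h "\<lambda>x y. 1"] assms by (simp add: real_sqrt_mult)
  moreover have "0 \<le> weighted_sum A B p (\<lambda>x y. (h x y)\<^sup>2) * weighted_sum A B p (\<lambda>x y. 1)"
    using assms by (intro mult_nonneg_nonneg weighted_sum_nonneg) auto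
  ultimately show ?thesis by (metis abs_le_square_iff real_sqrt_abs real_sqrt_le_iff)
qed

lemma weighted_sum_eq_0:
  assumes "\<And>x y. x \<in> A \<Longrightarrow> y \<in> B \<Longrightarrow> 0 \<le> p x y" and "weighted_sum A B p (\<lambda>x y. 1) = 0"
  shows "weighted_sum A B p h = 0"
  using weighted_sum_square_le[of A B p h] assms by simp

text \<open>Subtracting its mean from g leaves the covariance unchanged and does not increase the
  second moment, so functions g of mean 0 suffice.\<close>

lemma mixingI_centered:
  assumes p: "\<And>x y. x \<in> A \<Longrightarrow> y \<in> B \<Longrightarrow> 0 \<le> p x y" and "\<mu> \<ge> 0"
    and centered: "\<And>f g. weighted_sum A B p (\<lambda>x y. g y) = 0 \<Longrightarrow>
      \<bar>weighted_sum A B p (\<lambda>x y. f x * g y)\<bar> \<le>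
      \<mu> * (sqrt (weighted_sum A B p (\<lambda>x y. (f x)\<^sup>2)) * sqrt (weighted_sum A B p (\<lambda>x y. (g y)\<^sup>2)))"
  shows "mixing \<mu> A B p"
  unfolding mixing_def
proof (intro allI)
  fix f g
  let ?W = "weighted_sum A B p"
  define m where "m = ?W (\<lambda>x y. g y) / ?W (\<lambda>x y. 1)"
  have m: "m * ?W (\<lambda>x y. 1) = ?W (\<lambda>x y. g y)"
    using weighted_sum_eq_0[of A B p "\<lambda>x y. g y"] p by (cases "?W (\<lambda>x y. 1) = 0") (auto simp: m_def)
  have const: "?W (\<lambda>x y. c) = c * ?W (\<lambda>x y. 1)" for c
    using weighted_sum_cmult[of A B p c "\<lambda>x y. 1"] by simp
  have "?W (\<lambda>x y. g y - m) = 0" using m by (simp add: weighted_sum_diff const[of m])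
  from centered[OF this, of f]
  have le: "\<bar>?W (\<lambda>x y. f x * (g y - m))\<bar> \<le>
      \<mu> * (sqrt (?W (\<lambda>x y. (f x)\<^sup>2)) * sqrt (?W (\<lambda>x y. (g y - m)\<^sup>2)))" .
  have "?W (\<lambda>x y. f x * (g y - m)) = ?W (\<lambda>x y. f x * g y) - m * ?W (\<lambda>x y. f x)"
    by (simp add: right_diff_distrib weighted_sum_diff mult.commute[of _ m] weighted_sum_cmult)
  hence eq: "?W (\<lambda>x y. f x * (g y - m)) =
      ?W (\<lambda>x y. f x * g y) - ?W (\<lambda>x y. f x) * ?W (\<lambda>x y. g y) / ?W (\<lambda>x y. 1)"
    by (simp add: m_def mult.commute)
  \<comment> \<open>The second moment is the variance plus the square of the mean.\<close>
  have "?W (\<lambda>x y. (g y)\<^sup>2) = ?W (\<lambda>x y. (g y - m)\<^sup>2 + (2 * m) * (g y - m) + m\<^sup>2)"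
    by (simp add: power2_eq_square algebra_simps)
  also have "\<dots> = ?W (\<lambda>x y. (g y - m)\<^sup>2) + m\<^sup>2 * ?W (\<lambda>x y. 1)"
    using \<open>?W (\<lambda>x y. g y - m) = 0\<close>
    by (simp add: weighted_sum_add weighted_sum_cmult const[of "m\<^sup>2"])
  finally have "?W (\<lambda>x y. (g y - m)\<^sup>2) \<le> ?W (\<lambda>x y. (g y)\<^sup>2)"
    using weighted_sum_nonneg[of A B p "\<lambda>x y. 1"] p by simp
  hence "\<mu> * (sqrt (?W (\<lambda>x y. (f x)\<^sup>2)) * sqrt (?W (\<lambda>x y. (g y - m)\<^sup>2)))
      \<le> \<mu> * (sqrt (?W (\<lambda>x y. (f x)\<^sup>2)) * sqrt (?W (\<lambda>x y. (g y)\<^sup>2)))"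
    using \<open>\<mu> \<ge> 0\<close> p
    by (intro mult_left_mono real_sqrt_le_mono) (auto intro!: weighted_sum_nonneg)
  with le show "\<bar>?W (\<lambda>x y. f x * g y) - ?W (\<lambda>x y. f x) * ?W (\<lambda>x y. g y) / ?W (\<lambda>x y. 1)\<bar>
      \<le> \<mu> * (sqrt (?W (\<lambda>x y. (f x)\<^sup>2)) * sqrt (?W (\<lambda>x y. (g y)\<^sup>2)))"
    unfolding eq by linarith
qed

lemma mixing_one:
  assumes "\<And>x y. x \<in> A \<Longrightarrow> y \<in> B \<Longrightarrow> 0 \<le> p x y"
  shows "mixing 1 A B p"
proof (rule mixingI_centered)
  fix f g
  show "\<bar>weighted_sum A B p (\<lambda>x y. f x * g y)\<bar> \<le>
      1 * (sqrt (weighted_sum A B p (\<lambda>x y. (f x)\<^sup>2)) * sqrt (weighted_sum A B p (\<lambda>x y. (g y)\<^sup>2)))"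
    using weighted_sum_Cauchy_Schwarz[of A B p "\<lambda>x y. f x" "\<lambda>x y. g y"] assms by simp
qed (use assms in auto)

section \<open>Stability of covariance bounds under changes of weights and index sets\<close>

lemma mixing_mono:
  assumes "mixing \<mu> A B p" and "\<mu> \<le> \<nu>" and "\<And>x y. x \<in> A \<Longrightarrow> y \<in> B \<Longrightarrow> 0 \<le> p x y"
  shows "mixing \<nu> A B p"
  unfolding mixing_def
  by (intro allI order.trans[OF mixingD[OF assms(1)]] mult_right_mono assms(2))
    (use assms(3) in \<open>auto intro!: mult_nonneg_nonneg weighted_sum_nonneg\<close>)

text \<open>Both sides are homogeneous of degree 1 in the weights. This is what permits binomial
  factors and normalising constants to be ignored in the induction.\<close>

lemma mixing_scale:
  assumes "mixing \<mu> A B p" and "c \<ge> 0"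
  shows "mixing \<mu> A B (\<lambda>x y. c * p x y)"
proof -
  have c: "weighted_sum A B (\<lambda>x y. c * p x y) h = c * weighted_sum A B p h" for h
    by (simp add: weighted_sum_def sum_distrib_left mult_ac)
  show ?thesis
    unfolding mixing_def c
  proof (intro allI)
    fix f g
    let ?W = "weighted_sum A B p"
    have factor: "c * x - c * a * (c * b) / (c * w) = c * (x - a * b / w)" for x a b w :: real
      by (cases "c = 0") (simp_all add: right_diff_distrib)
    have "\<bar>c * ?W (\<lambda>x y. f x * g y) -
        c * ?W (\<lambda>x y. f x) * (c * ?W (\<lambda>x y. g y)) / (c * ?W (\<lambda>x y. 1))\<bar> =
        c * \<bar>?W (\<lambda>x y. f x * g y) - ?W (\<lambda>x y. f x) * ?W (\<lambda>x y. g y) / ?W (\<lambda>x y. 1)\<bar>"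
      unfolding factor abs_mult abs_of_nonneg[OF \<open>c \<ge> 0\<close>] ..
    also have "\<dots> \<le> c * (\<mu> * (sqrt (?W (\<lambda>x y. (f x)\<^sup>2)) * sqrt (?W (\<lambda>x y. (g y)\<^sup>2))))"
      by (intro mult_left_mono mixingD assms)
    also have "\<dots> = \<mu> * (sqrt (c * ?W (\<lambda>x y. (f x)\<^sup>2)) * sqrt (c * ?W (\<lambda>x y. (g y)\<^sup>2)))"
    proof -
      have merge: "sqrt c * a * (sqrt c * b) = c * (a * b)" for a b
      proof -
        have "sqrt c * a * (sqrt c * b) = (sqrt c * sqrt c) * (a * b)" by (simp only: mult_ac)
        thus ?thesis using \<open>c \<ge> 0\<close> by simp
      qed
      show ?thesis unfolding real_sqrt_mult merge by (rule mult.left_commute)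
    qed
    finally show "\<bar>c * ?W (\<lambda>x y. f x * g y) -
        c * ?W (\<lambda>x y. f x) * (c * ?W (\<lambda>x y. g y)) / (c * ?W (\<lambda>x y. 1))\<bar>
      \<le> \<mu> * (sqrt (c * ?W (\<lambda>x y. (f x)\<^sup>2)) * sqrt (c * ?W (\<lambda>x y. (g y)\<^sup>2)))" .
  qed
qed

lemma mixing_transpose:
  assumes "mixing \<mu> A B p"
  shows "mixing \<mu> B A (\<lambda>y x. p x y)"
  unfolding mixing_def
proof (intro allI)
  fix f g
  have swap: "weighted_sum B A (\<lambda>y x. p x y) h = weighted_sum A B p (\<lambda>x y. h y x)" for h
    by (rule weighted_sum_swap)
  show "\<bar>weighted_sum B A (\<lambda>y x. p x y) (\<lambda>x y. f x * g y) -
        weighted_sum B A (\<lambda>y x. p x y) (\<lambda>x y. f x) * weighted_sum B A (\<lambda>y x. p x y) (\<lambda>x y. g y) /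
        weighted_sum B A (\<lambda>y x. p x y) (\<lambda>x y. 1)\<bar>
      \<le> \<mu> * (sqrt (weighted_sum B A (\<lambda>y x. p x y) (\<lambda>x y. (f x)\<^sup>2)) *
              sqrt (weighted_sum B A (\<lambda>y x. p x y) (\<lambda>x y. (g y)\<^sup>2)))"
    using mixingD[OF assms, of g f] unfolding swap by (simp add: mult.commute)
qed

text \<open>Points outside the image carry no weight and drop out of every sum. The lemma identifies
  singletons with vertices and a face of the link of v with the same face enlarged by v.\<close>

lemma mixing_reindex:
  assumes fin: "finite A" and inj: "inj_on \<phi> A'" and sub: "\<phi> ` A' \<subseteq> A"
    and zero: "\<And>x y. x \<in> A - \<phi> ` A' \<Longrightarrow> y \<in> B \<Longrightarrow> p x y = 0"
    and mix: "mixing \<mu> A' B p'"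
    and eq: "\<And>x y. x \<in> A' \<Longrightarrow> y \<in> B \<Longrightarrow> p' x y = p (\<phi> x) y"
  shows "mixing \<mu> A B p"
proof -
  have re: "weighted_sum A B p h = weighted_sum A' B p' (\<lambda>x. h (\<phi> x))" for h
  proof -
    have "weighted_sum A B p h = (\<Sum>x\<in>\<phi> ` A'. \<Sum>y\<in>B. p x y * h x y)"
      unfolding weighted_sum_def by (rule sum.mono_neutral_right) (use fin sub zero in auto)
    also have "\<dots> = weighted_sum A' B p' (\<lambda>x. h (\<phi> x))"
      using eq by (simp add: weighted_sum_def sum.reindex[OF inj])
    finally show ?thesis .
  qed
  show ?thesis unfolding mixing_def re by (intro allI mixingD mix)
qed

lemma mixing_extend:
  assumes "finite A" "A' \<subseteq> A" and "\<And>x y. x \<in> A - A' \<Longrightarrow> y \<in> B \<Longrightarrow> p x y = 0"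
    and "mixing \<mu> A' B p"
  shows "mixing \<mu> A B p"
  by (rule mixing_reindex[where \<phi> = "\<lambda>x. x" and A' = A']) (use assms in auto)

lemma mixing_restrict:
  assumes "finite A" "A' \<subseteq> A" and "\<And>x y. x \<in> A - A' \<Longrightarrow> y \<in> B \<Longrightarrow> p x y = 0"
    and "mixing \<mu> A B p"
  shows "mixing \<mu> A' B p"
proof -
  have "weighted_sum A B p h = weighted_sum A' B p h" for h
    unfolding weighted_sum_def by (rule sum.mono_neutral_right) (use assms(1-3) in auto)
  thus ?thesis using assms(4) by (simp add: mixing_def)
qed

lemma mixing_cong:
  assumes "mixing \<mu> A B p" and "\<And>x y. x \<in> A \<Longrightarrow> y \<in> B \<Longrightarrow> p x y = p' x y"
  shows "mixing \<mu> A B p'"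
proof -
  have "weighted_sum A B p' h = weighted_sum A B p h" for h
    unfolding weighted_sum_def using assms(2) by (intro sum.cong refl) simp
  thus ?thesis using assms(1) by (simp add: mixing_def)
qed

lemma mixing_zero:
  assumes "\<And>x y. x \<in> A \<Longrightarrow> y \<in> B \<Longrightarrow> p x y = 0"
  shows "mixing \<mu> A B p"
  using assms by (simp add: mixing_def weighted_sum_def)

text \<open>On a one-point set f is constant, and a constant has covariance 0 with everything. This
  starts the induction, the point being the empty face.\<close>

lemma mixing_singleton:
  assumes p: "\<And>y. y \<in> B \<Longrightarrow> 0 \<le> p a y"
  shows "mixing 0 {a} B p"
  unfolding mixing_def
proof (intro allI)
  fix f g
  let ?W = "weighted_sum {a} B p"
  have fg: "?W (\<lambda>x y. f x * g y) = f a * ?W (\<lambda>x y. g y)"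
    "?W (\<lambda>x y. f x) = f a * ?W (\<lambda>x y. 1)"
    by (simp_all add: weighted_sum_def sum_distrib_left mult_ac)
  have "?W (\<lambda>x y. g y) = 0" if "?W (\<lambda>x y. 1) = 0"
    using weighted_sum_eq_0[of "{a}" B p "\<lambda>x y. g y"] p that by simp
  thus "\<bar>?W (\<lambda>x y. f x * g y) - ?W (\<lambda>x y. f x) * ?W (\<lambda>x y. g y) / ?W (\<lambda>x y. 1)\<bar>
      \<le> 0 * (sqrt (?W (\<lambda>x y. (f x)\<^sup>2)) * sqrt (?W (\<lambda>x y. (g y)\<^sup>2)))"
    unfolding fg by (cases "?W (\<lambda>x y. 1) = 0") auto
qed

text \<open>The law of total covariance for a triple (t, x, y) with weights \<open>q t x y\<close>.
  With m(t) the conditional mean of f given t, the covariance of f(x) and g(y) is the average of the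
  conditional covariances plus the covariance of m(t) and g(y). The first part is bounded locally,
  then summed by Cauchy-Schwarz over t; the second is bounded globally, since by Jensen m has no
  larger second moment than f. Only f is averaged, so the global condition concerns pairs (t,
  y).\<close>

lemma mixing_localization:
  fixes q :: "'t \<Rightarrow> 'a \<Rightarrow> 'b \<Rightarrow> real"
  assumes q: "\<And>t x y. t \<in> T \<Longrightarrow> x \<in> A \<Longrightarrow> y \<in> B \<Longrightarrow> 0 \<le> q t x y"
    and "\<mu> \<ge> 0" "\<nu> \<ge> 0"
    and local_mix: "\<And>t. t \<in> T \<Longrightarrow> mixing \<mu> A B (q t)"
    and global_mix: "mixing \<nu> T B (\<lambda>t y. \<Sum>x\<in>A. q t x y)"
  shows "mixing (\<mu> + \<nu>) A B (\<lambda>x y. \<Sum>t\<in>T. q t x y)"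
  unfolding mixing_def
proof (intro allI)
  fix f g
  let ?p = "\<lambda>x y. \<Sum>t\<in>T. q t x y"
  let ?Q = "\<lambda>t y. \<Sum>x\<in>A. q t x y"
  let ?V = "weighted_sum A B ?p"
  let ?W = "\<lambda>t. weighted_sum A B (q t)"
  define F where "F = sqrt (?V (\<lambda>x y. (f x)\<^sup>2))"
  define G where "G = sqrt (?V (\<lambda>x y. (g y)\<^sup>2))"
  define m where "m t = ?W t (\<lambda>x y. f x) / ?W t (\<lambda>x y. 1)" for t
  have V: "?V h = (\<Sum>t\<in>T. ?W t h)" for h
  proof -
    have "?V h = (\<Sum>x\<in>A. \<Sum>t\<in>T. \<Sum>y\<in>B. q t x y * h x y)"
      unfolding weighted_sum_def sum_distrib_right by (intro sum.cong refl sum.swap)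
    also have "\<dots> = (\<Sum>t\<in>T. ?W t h)" unfolding weighted_sum_def by (rule sum.swap)
    finally show ?thesis .
  qed
  have Q: "weighted_sum T B ?Q h = (\<Sum>t\<in>T. ?W t (\<lambda>x. h t))" for h
  proof -
    have "weighted_sum T B ?Q h = (\<Sum>t\<in>T. \<Sum>y\<in>B. \<Sum>x\<in>A. q t x y * h t y)"
      by (simp add: weighted_sum_def sum_distrib_right)
    also have "\<dots> = (\<Sum>t\<in>T. ?W t (\<lambda>x. h t))"
      unfolding weighted_sum_def by (intro sum.cong refl sum.swap)
    finally show ?thesis .
  qed
  have const: "?W t (\<lambda>x y. c) = c * ?W t (\<lambda>x y. 1)" for c t
    using weighted_sum_cmult[of A B "q t" c "\<lambda>x y. 1"] by simp
  have nonneg: "?W t (\<lambda>x y. h x y) \<ge> 0" if "t \<in> T" "\<And>x y. h x y \<ge> 0" for t h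
    using q that by (intro weighted_sum_nonneg) auto
  have m: "?W t (\<lambda>x y. m t) = ?W t (\<lambda>x y. f x)" if "t \<in> T" for t
    using weighted_sum_eq_0[of A B "q t" "\<lambda>x y. f x"] q[OF that]
    by (subst const, cases "?W t (\<lambda>x y. 1) = 0") (auto simp: m_def)
  have m2: "?W t (\<lambda>x y. (m t)\<^sup>2) \<le> ?W t (\<lambda>x y. (f x)\<^sup>2)" if "t \<in> T" for t
  proof (cases "?W t (\<lambda>x y. 1) = 0")
    case True
    have "?W t (\<lambda>x y. (m t)\<^sup>2) = 0" using True by (subst const) simp
    thus ?thesis using nonneg[OF that, of "\<lambda>x y. (f x)\<^sup>2"] by simp
  next
    case False
    have "?W t (\<lambda>x y. 1) > 0" using nonneg[OF that, of "\<lambda>x y. 1"] False by simp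
    moreover have "?W t (\<lambda>x y. (m t)\<^sup>2) = (?W t (\<lambda>x y. f x))\<^sup>2 / ?W t (\<lambda>x y. 1)"
      using False by (subst const) (simp add: m_def power_divide power2_eq_square)
    ultimately show ?thesis
      using weighted_sum_square_le[of A B "q t" "\<lambda>x y. f x"] q[OF that] by (simp add: divide_le_eq)
  qed
  \<comment> \<open>The weighted sum of m(t) g(y), the value that separates the two parts of the
    covariance.\<close>
  define X where "X = (\<Sum>t\<in>T. m t * ?W t (\<lambda>x y. g y))"
  have "\<bar>?V (\<lambda>x y. f x * g y) - X\<bar> \<le>
      (\<Sum>t\<in>T. \<bar>?W t (\<lambda>x y. f x * g y) - m t * ?W t (\<lambda>x y. g y)\<bar>)"
    unfolding V X_def sum_subtractf[symmetric] by (rule sum_abs)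
  also have "\<dots> \<le> (\<Sum>t\<in>T. \<mu> * (sqrt (?W t (\<lambda>x y. (f x)\<^sup>2)) * sqrt (?W t (\<lambda>x y. (g y)\<^sup>2))))"
    using mixingD[OF local_mix, of _ f g] by (intro sum_mono) (simp add: m_def)
  also have "\<dots> = \<mu> * (\<Sum>t\<in>T. sqrt (?W t (\<lambda>x y. (f x)\<^sup>2)) * sqrt (?W t (\<lambda>x y. (g y)\<^sup>2)))"
    by (simp add: sum_distrib_left)
  also have "\<dots> \<le> \<mu> * (F * G)"
  proof (rule mult_left_mono[OF _ \<open>\<mu> \<ge> 0\<close>])
    have "(\<Sum>t\<in>T. (sqrt (?W t (\<lambda>x y. (f x)\<^sup>2)))\<^sup>2) = ?V (\<lambda>x y. (f x)\<^sup>2)"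
      "(\<Sum>t\<in>T. (sqrt (?W t (\<lambda>x y. (g y)\<^sup>2)))\<^sup>2) = ?V (\<lambda>x y. (g y)\<^sup>2)"
      unfolding V by (intro sum.cong refl real_sqrt_pow2 nonneg; simp)+
    thus "(\<Sum>t\<in>T. sqrt (?W t (\<lambda>x y. (f x)\<^sup>2)) * sqrt (?W t (\<lambda>x y. (g y)\<^sup>2))) \<le> F * G"
      using sum_mult_le_sqrt[of "\<lambda>t. sqrt (?W t (\<lambda>x y. (f x)\<^sup>2))" "\<lambda>t. sqrt (?W t (\<lambda>x y. (g y)\<^sup>2))" T]
      unfolding F_def G_def by simp
  qed
  finally have 1: "\<bar>?V (\<lambda>x y. f x * g y) - X\<bar> \<le> \<mu> * (F * G)" .
  have "\<bar>X - ?V (\<lambda>x y. f x) * ?V (\<lambda>x y. g y) / ?V (\<lambda>x y. 1)\<bar> \<le>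
      \<nu> * (sqrt (\<Sum>t\<in>T. ?W t (\<lambda>x y. (m t)\<^sup>2)) * G)"
  proof -
    have "(\<Sum>t\<in>T. ?W t (\<lambda>x y. m t)) = ?V (\<lambda>x y. f x)"
      unfolding V by (intro sum.cong refl m)
    thus ?thesis
      using mixingD[OF global_mix, of m g] unfolding Q G_def V[symmetric]
      by (simp add: X_def weighted_sum_cmult)
  qed
  also have "\<dots> \<le> \<nu> * (F * G)"
    unfolding F_def G_def using \<open>\<nu> \<ge> 0\<close> m2
    by (intro mult_left_mono mult_right_mono real_sqrt_le_mono)
      (auto simp: V intro!: sum_mono sum_nonneg nonneg)
  finally have "\<bar>X - ?V (\<lambda>x y. f x) * ?V (\<lambda>x y. g y) / ?V (\<lambda>x y. 1)\<bar> \<le> \<nu> * (F * G)" .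
  with 1 show "\<bar>?V (\<lambda>x y. f x * g y) - ?V (\<lambda>x y. f x) * ?V (\<lambda>x y. g y) / ?V (\<lambda>x y. 1)\<bar>
      \<le> (\<mu> + \<nu>) * (sqrt (?V (\<lambda>x y. (f x)\<^sup>2)) * sqrt (?V (\<lambda>x y. (g y)\<^sup>2)))"
    unfolding F_def[symmetric] G_def[symmetric] distrib_right by linarith
qed

section \<open>Covariance bounds and singular values\<close>

lemma sum_from_nat_into:
  "finite A \<Longrightarrow> (\<Sum>i<card A. h (from_nat_into A i)) = (\<Sum>x\<in>A. h x)"
  by (rule sum.reindex_bij_betw[OF bij_betw_from_nat_into_finite])

text \<open>The enumeration is a bijection, so each vector comes from a function on the set;
  quantifiers over vectors thus turn into quantifiers over functions.\<close>

lemma from_nat_into_surj_fun: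
  assumes "finite A"
  obtains f where "\<And>i. i < card A \<Longrightarrow> f (from_nat_into A i) = F i"
proof -
  have "the_inv_into {..<card A} (from_nat_into A) (from_nat_into A i) = i" if "i < card A" for i
    using bij_betw_from_nat_into_finite[OF assms] that
    by (intro the_inv_into_f_f) (auto simp: bij_betw_def)
  thus ?thesis by (intro that[of "\<lambda>x. F (the_inv_into {..<card A} (from_nat_into A) x)"]) simp
qed

lemma matrix_on_carrier: "matrix_on A B m \<in> carrier_mat (card A) (card B)"
  by (simp add: matrix_on_def)

lemma matrix_on_cong:
  assumes "finite A" "finite B" and "\<And>x y. x \<in> A \<Longrightarrow> y \<in> B \<Longrightarrow> m x y = m' x y"
  shows "matrix_on A B m = matrix_on A B m'"
proof -
  have "from_nat_into A i \<in> A" if "i < card A" for i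
    using that assms(1) by (intro from_nat_into) auto
  moreover have "from_nat_into B i \<in> B" if "i < card B" for i
    using that assms(2) by (intro from_nat_into) auto
  ultimately show ?thesis unfolding matrix_on_def by (intro eq_matI) (auto simp: assms(3))
qed

lemma matrix_on_apply:
  assumes "finite A" "finite B" and "\<And>j. j < card B \<Longrightarrow> f (from_nat_into B j) = F j"
  shows "(\<Sum>k<card A. (\<Sum>j<card B. matrix_on A B m $$ (k, j) * F j)\<^sup>2) =
    (\<Sum>x\<in>A. (\<Sum>y\<in>B. m x y * f y)\<^sup>2)"
proof -
  have "(\<Sum>j<card B. matrix_on A B m $$ (k, j) * F j) =
      (\<Sum>y\<in>B. m (from_nat_into A k) y * f y)" if "k < card A" for k
    unfolding sum_from_nat_into[OF assms(2), symmetric]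
    using that assms(3) by (intro sum.cong refl) (simp add: matrix_on_def)
  hence "(\<Sum>k<card A. (\<Sum>j<card B. matrix_on A B m $$ (k, j) * F j)\<^sup>2) =
      (\<Sum>k<card A. (\<Sum>y\<in>B. m (from_nat_into A k) y * f y)\<^sup>2)" by simp
  also have "\<dots> = (\<Sum>x\<in>A. (\<Sum>y\<in>B. m x y * f y)\<^sup>2)"
    by (rule sum_from_nat_into[OF assms(1)])
  finally show ?thesis .
qed

lemma second_singular_value_matrix_on_leI:
  fixes m :: "'a \<Rightarrow> 'b \<Rightarrow> real"
  assumes fin: "finite A" "finite B" and "\<mu> \<ge> 0"
    and contract: "\<And>f. (\<Sum>y\<in>B. u y * f y) = 0 \<Longrightarrow>
      (\<Sum>x\<in>A. (\<Sum>y\<in>B. m x y * f y)\<^sup>2) \<le> \<mu>\<^sup>2 * (\<Sum>y\<in>B. (f y)\<^sup>2)"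
  shows "second_singular_value (matrix_on A B m) \<le> \<mu>"
proof (rule second_singular_value_leI[OF matrix_on_carrier \<open>\<mu> \<ge> 0\<close>])
  fix F assume F0: "(\<Sum>j<card B. u (from_nat_into B j) * F j) = 0"
  obtain f where f: "\<And>j. j < card B \<Longrightarrow> f (from_nat_into B j) = F j"
    using from_nat_into_surj_fun[OF fin(2)] by blast
  have "(\<Sum>y\<in>B. u y * f y) = 0" "(\<Sum>j<card B. (F j)\<^sup>2) = (\<Sum>y\<in>B. (f y)\<^sup>2)"
    unfolding sum_from_nat_into[OF fin(2), symmetric] using F0 f by simp_all
  thus "(\<Sum>k<card A. (\<Sum>j<card B. matrix_on A B m $$ (k, j) * F j)\<^sup>2)
      \<le> \<mu>\<^sup>2 * (\<Sum>j<card B. (F j)\<^sup>2)"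
    using contract[of f] matrix_on_apply[where f = f and F = F and m = m, OF fin f] by simp
qed

lemma second_singular_value_matrix_on_leD:
  fixes m :: "'a \<Rightarrow> 'b \<Rightarrow> real"
  assumes fin: "finite A" "finite B" and \<mu>: "0 \<le> \<mu>" "\<mu> < 1"
    and le: "second_singular_value (matrix_on A B m) \<le> \<mu>"
    and norm: "\<And>f. (\<Sum>x\<in>A. (\<Sum>y\<in>B. m x y * f y)\<^sup>2) \<le> (\<Sum>y\<in>B. (f y)\<^sup>2)"
    and top: "(\<Sum>x\<in>A. (\<Sum>y\<in>B. m x y * u y)\<^sup>2) = (\<Sum>y\<in>B. (u y)\<^sup>2)"
    and u: "(\<Sum>y\<in>B. (u y)\<^sup>2) \<noteq> 0"
    and f: "(\<Sum>y\<in>B. u y * f y) = 0"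
  shows "(\<Sum>x\<in>A. (\<Sum>y\<in>B. m x y * f y)\<^sup>2) \<le> \<mu>\<^sup>2 * (\<Sum>y\<in>B. (f y)\<^sup>2)"
proof -
  have apply_f: "(\<Sum>k<card A. (\<Sum>j<card B. matrix_on A B m $$ (k, j) * f (from_nat_into B j))\<^sup>2) =
      (\<Sum>x\<in>A. (\<Sum>y\<in>B. m x y * f y)\<^sup>2)" for f
    by (rule matrix_on_apply[OF fin refl])
  have square: "(\<Sum>j<card B. (f (from_nat_into B j))\<^sup>2) = (\<Sum>y\<in>B. (f y)\<^sup>2)" for f :: "'b \<Rightarrow> real"
    by (rule sum_from_nat_into[OF fin(2)])
  have "(\<Sum>k<card A. (\<Sum>j<card B. matrix_on A B m $$ (k, j) * f (from_nat_into B j))\<^sup>2)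
      \<le> \<mu>\<^sup>2 * (\<Sum>j<card B. (f (from_nat_into B j))\<^sup>2)"
  proof (rule second_singular_value_leD[OF matrix_on_carrier \<mu> le])
    fix F :: "nat \<Rightarrow> real"
    obtain f where f: "\<And>j. j < card B \<Longrightarrow> f (from_nat_into B j) = F j"
      using from_nat_into_surj_fun[OF fin(2)] by blast
    have "(\<Sum>j<card B. (F j)\<^sup>2) = (\<Sum>y\<in>B. (f y)\<^sup>2)" using f square[of f] by simp
    thus "(\<Sum>k<card A. (\<Sum>j<card B. matrix_on A B m $$ (k, j) * F j)\<^sup>2) \<le> (\<Sum>j<card B. (F j)\<^sup>2)"
      using norm[of f] matrix_on_apply[where f = f and F = F and m = m, OF fin f] by simp
  next
    show "(\<Sum>k<card A. (\<Sum>j<card B. matrix_on A B m $$ (k, j) * u (from_nat_into B j))\<^sup>2) =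
        (\<Sum>j<card B. (u (from_nat_into B j))\<^sup>2)"
      using top by (simp only: apply_f square)
    show "(\<Sum>j<card B. (u (from_nat_into B j))\<^sup>2) \<noteq> 0" using u by (simp add: square)
    show "(\<Sum>j<card B. u (from_nat_into B j) * f (from_nat_into B j)) = 0"
      using f sum_from_nat_into[OF fin(2), of "\<lambda>y. u y * f y"] by simp
  qed
  thus ?thesis by (simp only: apply_f square)
qed

section \<open>Normalised kernels of weighted bipartite graphs\<close>

text \<open>For nonnegative weights p this is the matrix of the conditional expectation of f(y)
  given x, in the orthonormal bases of normalised indicators. The normalised adjacency matrix of a
  link and the matrix of the swap walk are both of this form. Points of marginal weight 0 give zero
  rows and columns.\<close>

definition normalized_kernel :: "'a set \<Rightarrow> 'b set \<Rightarrow> ('a \<Rightarrow> 'b \<Rightarrow> real) \<Rightarrow> 'a \<Rightarrow> 'b \<Rightarrow> real" where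
  "normalized_kernel A B p x y = p x y / (sqrt (\<Sum>y'\<in>B. p x y') * sqrt (\<Sum>x'\<in>A. p x' y))"

text \<open>The terms agree where \<open>r x\<close> is positive. Where it is 0 the left term
  vanishes, which is why only an inequality remains.\<close>

lemma weighted_sum_sqrt_le:
  assumes "\<And>x. x \<in> A \<Longrightarrow> 0 \<le> (r x :: real)"
  shows "(\<Sum>x\<in>A. r x * (g x / sqrt (r x))\<^sup>2) \<le> (\<Sum>x\<in>A. (g x)\<^sup>2)"
  using assms by (intro sum_mono) (auto simp: power_divide)

lemma normalized_kernel_bilinear:
  "(\<Sum>x\<in>A. g x * (\<Sum>y\<in>B. normalized_kernel A B p x y * f y)) =
   weighted_sum A B p (\<lambda>x y. g x / sqrt (\<Sum>y'\<in>B. p x y') * (f y / sqrt (\<Sum>x'\<in>A. p x' y)))"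
  by (simp add: weighted_sum_def normalized_kernel_def sum_distrib_left sum_distrib_right mult_ac)

text \<open>Duality: with the image of f as the test function, the bilinear bound reads N \<le>
  \<mu> sqrt N |f| for the squared norm N of the image, and one factor sqrt N cancels.\<close>

lemma normalized_kernel_norm_le:
  fixes p :: "'a \<Rightarrow> 'b \<Rightarrow> real" and f :: "'b \<Rightarrow> real"
  assumes p: "\<And>x y. x \<in> A \<Longrightarrow> y \<in> B \<Longrightarrow> 0 \<le> p x y" and "\<mu> \<ge> 0"
  defines "f' \<equiv> \<lambda>y. f y / sqrt (\<Sum>x\<in>A. p x y)"
  assumes bound: "\<And>g. \<bar>weighted_sum A B p (\<lambda>x y. g x * f' y)\<bar> \<le>
    \<mu> * (sqrt (weighted_sum A B p (\<lambda>x y. (g x)\<^sup>2)) * sqrt (weighted_sum A B p (\<lambda>x y. (f' y)\<^sup>2)))"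
  shows "(\<Sum>x\<in>A. (\<Sum>y\<in>B. normalized_kernel A B p x y * f y)\<^sup>2) \<le> \<mu>\<^sup>2 * (\<Sum>y\<in>B. (f y)\<^sup>2)"
proof -
  define r where "r x = (\<Sum>y\<in>B. p x y)" for x
  define c where "c y = (\<Sum>x\<in>A. p x y)" for y
  have r: "r x \<ge> 0" if "x \<in> A" for x using p that by (auto simp: r_def intro!: sum_nonneg)
  have c: "c y \<ge> 0" if "y \<in> B" for y using p that by (auto simp: c_def intro!: sum_nonneg)
  have f': "f' y = f y / sqrt (c y)" for y by (simp add: f'_def c_def)
  define g where "g x = (\<Sum>y\<in>B. normalized_kernel A B p x y * f y)" for x
  define N where "N = (\<Sum>x\<in>A. (g x)\<^sup>2)"
  define g' where "g' x = g x / sqrt (r x)" for x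
  have N: "N = weighted_sum A B p (\<lambda>x y. g' x * f' y)"
    using normalized_kernel_bilinear[of g A B p f]
    by (simp add: N_def g_def[symmetric] power2_eq_square f' g'_def r_def c_def)
  have f'2: "weighted_sum A B p (\<lambda>x y. (f' y)\<^sup>2) \<le> (\<Sum>y\<in>B. (f y)\<^sup>2)"
    unfolding weighted_sum_right c_def[symmetric] f' by (rule weighted_sum_sqrt_le[OF c])
  have g'2: "weighted_sum A B p (\<lambda>x y. (g' x)\<^sup>2) \<le> N"
    unfolding weighted_sum_left r_def[symmetric] g'_def N_def by (rule weighted_sum_sqrt_le[OF r])
  have "N \<le> \<mu> * (sqrt (weighted_sum A B p (\<lambda>x y. (g' x)\<^sup>2)) * sqrt (weighted_sum A B p (\<lambda>x y. (f' y)\<^sup>2)))"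
    using bound[of g'] by (simp add: N[symmetric])
  also have "\<dots> \<le> \<mu> * (sqrt N * sqrt (\<Sum>y\<in>B. (f y)\<^sup>2))"
    using \<open>\<mu> \<ge> 0\<close> f'2 g'2 p
    by (intro mult_left_mono mult_mono real_sqrt_le_mono)
      (auto simp: N_def intro!: weighted_sum_nonneg sum_nonneg)
  finally have le: "N \<le> \<mu> * (sqrt N * sqrt (\<Sum>y\<in>B. (f y)\<^sup>2))" .
  have "N \<ge> 0" by (simp add: N_def sum_nonneg)
  have "sqrt N \<le> \<mu> * sqrt (\<Sum>y\<in>B. (f y)\<^sup>2)"
  proof (cases "N = 0")
    case True
    thus ?thesis using \<open>\<mu> \<ge> 0\<close> by (simp add: sum_nonneg)
  next
    case False
    have "sqrt N * sqrt N \<le> sqrt N * (\<mu> * sqrt (\<Sum>y\<in>B. (f y)\<^sup>2))"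
      using le \<open>N \<ge> 0\<close> by (simp add: mult_ac)
    thus ?thesis by (rule mult_left_le_imp_le) (use False \<open>N \<ge> 0\<close> in simp)
  qed
  hence "(sqrt N)\<^sup>2 \<le> (\<mu> * sqrt (\<Sum>y\<in>B. (f y)\<^sup>2))\<^sup>2" using \<open>N \<ge> 0\<close> by (intro power_mono) auto
  hence "N \<le> \<mu>\<^sup>2 * (\<Sum>y\<in>B. (f y)\<^sup>2)" using \<open>N \<ge> 0\<close> by (simp add: power_mult_distrib sum_nonneg)
  thus ?thesis by (simp add: N_def g_def)
qed

lemma normalized_kernel_contraction:
  assumes p: "\<And>x y. x \<in> A \<Longrightarrow> y \<in> B \<Longrightarrow> 0 \<le> p x y"
  shows "(\<Sum>x\<in>A. (\<Sum>y\<in>B. normalized_kernel A B p x y * f y)\<^sup>2) \<le> (\<Sum>y\<in>B. (f y)\<^sup>2)"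
proof -
  have "(\<Sum>x\<in>A. (\<Sum>y\<in>B. normalized_kernel A B p x y * f y)\<^sup>2) \<le> 1\<^sup>2 * (\<Sum>y\<in>B. (f y)\<^sup>2)"
  proof (rule normalized_kernel_norm_le[OF p])
    fix g
    show "\<bar>weighted_sum A B p (\<lambda>x y. g x * (f y / sqrt (\<Sum>x\<in>A. p x y)))\<bar> \<le>
      1 * (sqrt (weighted_sum A B p (\<lambda>x y. (g x)\<^sup>2)) *
        sqrt (weighted_sum A B p (\<lambda>x y. (f y / sqrt (\<Sum>x\<in>A. p x y))\<^sup>2)))"
      unfolding mult_1 by (rule weighted_sum_Cauchy_Schwarz[OF p])
  qed simp_all
  thus ?thesis by simp
qed

text \<open>The constant function 1 has coordinates sqrt(c y), where c is the column sum.
  Orthogonality to this vector says that the rescaled function \<open>f'\<close> has mean 0, so the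
  product of means in \<open>mixing\<close> disappears.\<close>

lemma second_singular_value_le_of_mixing:
  fixes p :: "'a \<Rightarrow> 'b \<Rightarrow> real"
  assumes fin: "finite A" "finite B" and p: "\<And>x y. x \<in> A \<Longrightarrow> y \<in> B \<Longrightarrow> 0 \<le> p x y"
    and "\<mu> \<ge> 0" and mix: "mixing \<mu> A B p"
  shows "second_singular_value (matrix_on A B (normalized_kernel A B p)) \<le> \<mu>"
proof (rule second_singular_value_matrix_on_leI[OF fin \<open>\<mu> \<ge> 0\<close>])
  fix f assume f: "(\<Sum>y\<in>B. sqrt (\<Sum>x\<in>A. p x y) * f y) = 0"
  define c where "c y = (\<Sum>x\<in>A. p x y)" for y
  define f' where "f' y = f y / sqrt (c y)" for y
  have c: "c y \<ge> 0" if "y \<in> B" for y using p that by (auto simp: c_def intro!: sum_nonneg)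
  have "weighted_sum A B p (\<lambda>x y. f' y) = (\<Sum>y\<in>B. sqrt (c y) * f y)"
    unfolding weighted_sum_right c_def[symmetric] f'_def
    by (intro sum.cong refl) (use c real_div_sqrt in \<open>metis times_divide_eq_right times_divide_eq_left\<close>)
  hence 0: "weighted_sum A B p (\<lambda>x y. f' y) = 0" using f by (simp add: c_def)
  show "(\<Sum>x\<in>A. (\<Sum>y\<in>B. normalized_kernel A B p x y * f y)\<^sup>2) \<le> \<mu>\<^sup>2 * (\<Sum>y\<in>B. (f y)\<^sup>2)"
  proof (rule normalized_kernel_norm_le[OF p \<open>\<mu> \<ge> 0\<close>])
    fix g
    show "\<bar>weighted_sum A B p (\<lambda>x y. g x * (f y / sqrt (\<Sum>x\<in>A. p x y)))\<bar> \<le>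
      \<mu> * (sqrt (weighted_sum A B p (\<lambda>x y. (g x)\<^sup>2)) *
        sqrt (weighted_sum A B p (\<lambda>x y. (f y / sqrt (\<Sum>x\<in>A. p x y))\<^sup>2)))"
      using mixingD[OF mix, of g f'] unfolding 0 by (simp only: f'_def c_def mult_zero_right div_0 diff_zero)
  qed
qed

text \<open>Apart from the cases \<mu> \<ge> 1 and zero weights, the vector sqrt(c y) of the
  constants is a singular vector of value 1, and the contraction on its complement is the covariance
  bound in orthonormal coordinates.\<close>

lemma mixing_of_second_singular_value_le:
  fixes p :: "'a \<Rightarrow> 'b \<Rightarrow> real"
  assumes fin: "finite A" "finite B" and p: "\<And>x y. x \<in> A \<Longrightarrow> y \<in> B \<Longrightarrow> 0 \<le> p x y"
    and "\<mu> \<ge> 0" and le: "second_singular_value (matrix_on A B (normalized_kernel A B p)) \<le> \<mu>"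
  shows "mixing \<mu> A B p"
proof -
  consider "\<mu> \<ge> 1" | "\<And>x y. x \<in> A \<Longrightarrow> y \<in> B \<Longrightarrow> p x y = 0"
    | "\<mu> < 1" "weighted_sum A B p (\<lambda>x y. 1) \<noteq> 0"
  proof (cases "\<mu> < 1 \<and> weighted_sum A B p (\<lambda>x y. 1) = 0")
    case True
    hence "(\<Sum>x\<in>A. \<Sum>y\<in>B. p x y) = 0" by (simp add: weighted_sum_def)
    hence "\<forall>x\<in>A. (\<Sum>y\<in>B. p x y) = 0"
      using fin p by (subst (asm) sum_nonneg_eq_0_iff) (auto intro!: sum_nonneg)
    hence "\<forall>x\<in>A. \<forall>y\<in>B. p x y = 0"
      using fin p by (simp add: sum_nonneg_eq_0_iff)
    thus ?thesis using that(2) by blast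
  qed (use that in force)
  thus ?thesis
  proof cases
    case 1
    thus ?thesis using mixing_mono[OF mixing_one] p by blast
  next
    case 2
    thus ?thesis by (rule mixing_zero)
  next
    case 3
    define r where "r x = (\<Sum>y\<in>B. p x y)" for x
    define c where "c y = (\<Sum>x\<in>A. p x y)" for y
    have r: "r x \<ge> 0" if "x \<in> A" for x using p that by (auto simp: r_def intro!: sum_nonneg)
    have c: "c y \<ge> 0" if "y \<in> B" for y using p that by (auto simp: c_def intro!: sum_nonneg)
    let ?m = "normalized_kernel A B p"
    have m: "?m x y = p x y / (sqrt (r x) * sqrt (c y))" for x y
      by (simp add: normalized_kernel_def r_def c_def)
    have pr: "p x y = 0" if "x \<in> A" "y \<in> B" "r x = 0" for x y
      using that fin p by (simp add: r_def sum_nonneg_eq_0_iff)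
    have pc: "p x y = 0" if "x \<in> A" "y \<in> B" "c y = 0" for x y
      using that fin p by (simp add: c_def sum_nonneg_eq_0_iff)
    \<comment> \<open>Where a marginal vanishes, so does the whole column or row of p; hence these
      identities survive the division by zero.\<close>
    have mc: "?m x y * sqrt (c y) = p x y / sqrt (r x)" if "x \<in> A" "y \<in> B" for x y
      using pc[OF that] by (cases "c y = 0") (auto simp: m)
    have mrc: "sqrt (r x) * (?m x y * sqrt (c y)) = p x y" if "x \<in> A" "y \<in> B" for x y
      using pr[OF that] by (cases "r x = 0") (auto simp: mc[OF that])
    \<comment> \<open>The kernel maps sqrt(c) to sqrt(r), and both have the total weight as squared
      norm.\<close>
    have "(\<Sum>x\<in>A. (\<Sum>y\<in>B. ?m x y * sqrt (c y))\<^sup>2) = (\<Sum>x\<in>A. (r x / sqrt (r x))\<^sup>2)"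
      by (simp add: mc r_def sum_divide_distrib)
    also have "\<dots> = (\<Sum>x\<in>A. r x)"
      using r by (intro sum.cong refl) (simp add: real_div_sqrt)
    also have "\<dots> = (\<Sum>y\<in>B. c y)" unfolding r_def c_def by (rule sum.swap)
    also have "\<dots> = (\<Sum>y\<in>B. (sqrt (c y))\<^sup>2)" using c by simp
    finally have top: "(\<Sum>x\<in>A. (\<Sum>y\<in>B. ?m x y * sqrt (c y))\<^sup>2) = (\<Sum>y\<in>B. (sqrt (c y))\<^sup>2)" .
    have nz: "(\<Sum>y\<in>B. (sqrt (c y))\<^sup>2) \<noteq> 0"
      using 3(2) c weighted_sum_right[of A B p "\<lambda>_. 1"] by (simp add: c_def)
    show ?thesis
    proof (rule mixingI_centered[OF p \<open>\<mu> \<ge> 0\<close>])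
      fix f g assume g0: "weighted_sum A B p (\<lambda>x y. g y) = 0"
      define G where "G y = sqrt (c y) * g y" for y
      define F where "F x = sqrt (r x) * f x" for x
      have F2: "weighted_sum A B p (\<lambda>x y. (f x)\<^sup>2) = (\<Sum>x\<in>A. (F x)\<^sup>2)"
        unfolding weighted_sum_left r_def[symmetric] F_def using r by (simp add: power_mult_distrib)
      have G2: "weighted_sum A B p (\<lambda>x y. (g y)\<^sup>2) = (\<Sum>y\<in>B. (G y)\<^sup>2)"
        unfolding weighted_sum_right c_def[symmetric] G_def using c by (simp add: power_mult_distrib)
      have "(\<Sum>y\<in>B. sqrt (c y) * G y) = (\<Sum>y\<in>B. c y * g y)"
        using c by (simp add: G_def flip: mult.assoc)
      also have "\<dots> = 0" using g0 unfolding weighted_sum_right c_def .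
      finally have G: "(\<Sum>x\<in>A. (\<Sum>y\<in>B. ?m x y * G y)\<^sup>2) \<le> \<mu>\<^sup>2 * (\<Sum>y\<in>B. (G y)\<^sup>2)"
        using normalized_kernel_contraction[of A B p] p
        by (intro second_singular_value_matrix_on_leD[OF fin \<open>\<mu> \<ge> 0\<close> 3(1) le _ top nz]) auto
      have "weighted_sum A B p (\<lambda>x y. f x * g y) = (\<Sum>x\<in>A. F x * (\<Sum>y\<in>B. ?m x y * G y))"
        unfolding weighted_sum_def sum_distrib_left
      proof (intro sum.cong refl)
        fix x y assume "x \<in> A" "y \<in> B"
        from mrc[OF this] show "p x y * (f x * g y) = F x * (?m x y * G y)"
          by (simp add: F_def G_def mult_ac)
      qed
      hence "\<bar>weighted_sum A B p (\<lambda>x y. f x * g y)\<bar> \<le>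
          sqrt (\<Sum>x\<in>A. (F x)\<^sup>2) * sqrt (\<Sum>x\<in>A. (\<Sum>y\<in>B. ?m x y * G y)\<^sup>2)"
        using sum_mult_le_sqrt[of F _ A] by simp
      also have "\<dots> \<le> sqrt (\<Sum>x\<in>A. (F x)\<^sup>2) * sqrt (\<mu>\<^sup>2 * (\<Sum>y\<in>B. (G y)\<^sup>2))"
        by (intro mult_left_mono real_sqrt_le_mono G) (simp add: sum_nonneg)
      also have "\<dots> = \<mu> * (sqrt (\<Sum>x\<in>A. (F x)\<^sup>2) * sqrt (\<Sum>y\<in>B. (G y)\<^sup>2))"
        using \<open>\<mu> \<ge> 0\<close> by (simp add: real_sqrt_mult)
      finally show "\<bar>weighted_sum A B p (\<lambda>x y. f x * g y)\<bar> \<le> \<mu> *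
          (sqrt (weighted_sum A B p (\<lambda>x y. (f x)\<^sup>2)) * sqrt (weighted_sum A B p (\<lambda>x y. (g y)\<^sup>2)))"
        unfolding F2 G2 .
    qed
  qed
qed

section \<open>Localisation of swap walks\<close>

text \<open>A common index set for the kernels of all links: sets that are not faces of a link stay
  in and receive weight 0.\<close>

definition ksubsets :: "'a set \<Rightarrow> nat \<Rightarrow> 'a set set" where
  "ksubsets V a = {A. A \<subseteq> V \<and> card A = a}"

lemma finite_ksubsets [simp]: "finite V \<Longrightarrow> finite (ksubsets V a)"
  by (simp add: ksubsets_def)

lemma ksubsets_0: "finite V \<Longrightarrow> ksubsets V 0 = {{}}"
  by (auto simp: ksubsets_def card_eq_0_iff finite_subset)

text \<open>Up to the factor \<open>d choose card s\<close> this is the mass of s under the induced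
  measure on faces of its size. One function thus serves all sizes and all links, without repeated
  deletion.\<close>

definition up_prob :: "'a set pmf \<Rightarrow> 'a set \<Rightarrow> real" where
  "up_prob P s = measure_pmf.prob P {t. s \<subseteq> t}"

lemma up_prob_nonneg [simp]: "0 \<le> up_prob P s"
  by (simp add: up_prob_def)

lemma up_prob_conv_sum:
  assumes "finite (set_pmf P)"
  shows "up_prob P s = (\<Sum>t\<in>set_pmf P. if s \<subseteq> t then pmf P t else 0)"
proof -
  have "up_prob P s = measure_pmf.prob P ({t. s \<subseteq> t} \<inter> set_pmf P)"
    unfolding up_prob_def by (rule measure_Int_set_pmf[symmetric])
  also have "\<dots> = (\<Sum>t\<in>{t. s \<subseteq> t} \<inter> set_pmf P. pmf P t)"
    using assms by (intro measure_measure_pmf_finite) auto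
  also have "\<dots> = (\<Sum>t\<in>set_pmf P. if s \<subseteq> t then pmf P t else 0)"
    using assms by (subst sum.If_cases) (auto simp: Int_commute)
  finally show ?thesis .
qed

lemma up_prob_eq_0:
  assumes "\<And>t. t \<in> set_pmf P \<Longrightarrow> \<not> s \<subseteq> t"
  shows "up_prob P s = 0"
proof -
  have "up_prob P s = measure_pmf.prob P ({t. s \<subseteq> t} \<inter> set_pmf P)"
    unfolding up_prob_def by (rule measure_Int_set_pmf[symmetric])
  also have "{t. s \<subseteq> t} \<inter> set_pmf P = {}" using assms by auto
  finally show ?thesis by simp
qed

text \<open>
  Up to normalisation, this is the joint law of the two endpoints of a step of the swap walk in the
  link of \<open>s\<close>.
\<close>
definition swap_kernel :: "'a set pmf \<Rightarrow> 'a set \<Rightarrow> 'a set \<Rightarrow> 'a set \<Rightarrow> real" where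
  "swap_kernel P s A B =
     (if A \<inter> B = {} \<and> A \<inter> s = {} \<and> B \<inter> s = {} then up_prob P (s \<union> A \<union> B) else 0)"

lemma swap_kernel_nonneg [simp]: "0 \<le> swap_kernel P s A B"
  by (simp add: swap_kernel_def)

lemma swap_kernel_commute: "swap_kernel P s A B = swap_kernel P s B A"
  by (simp add: swap_kernel_def Un_ac Int_ac conj_ac)

context
  fixes V :: "'a set" and P :: "'a set pmf" and d :: nat
  assumes V: "finite V" and P: "set_pmf P \<subseteq> ksubsets V d"
begin

lemma finite_support: "finite (set_pmf P)"
  using finite_subset[OF P] V by simp

text \<open>Double counting: a top face t containing U contains U \<union> B for exactly as many B
  as \<open>t - U\<close> has subsets of size b.\<close>

lemma sum_up_prob:
  assumes "finite U"
  shows "(\<Sum>B\<in>ksubsets (V - U) b. up_prob P (U \<union> B)) = real ((d - card U) choose b) * up_prob P U"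
proof -
  have "(\<Sum>B\<in>ksubsets (V - U) b. up_prob P (U \<union> B)) =
      (\<Sum>t\<in>set_pmf P. \<Sum>B\<in>ksubsets (V - U) b. if U \<union> B \<subseteq> t then pmf P t else 0)"
    unfolding up_prob_conv_sum[OF finite_support] by (rule sum.swap)
  also have "\<dots> = (\<Sum>t\<in>set_pmf P. real ((d - card U) choose b) * (if U \<subseteq> t then pmf P t else 0))"
  proof (intro sum.cong refl)
    fix t assume "t \<in> set_pmf P"
    hence t: "t \<subseteq> V" "card t = d" using P by (auto simp: ksubsets_def)
    show "(\<Sum>B\<in>ksubsets (V - U) b. if U \<union> B \<subseteq> t then pmf P t else 0) =
        real ((d - card U) choose b) * (if U \<subseteq> t then pmf P t else 0)"
    proof (cases "U \<subseteq> t")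
      case True
      have "(\<Sum>B\<in>ksubsets (V - U) b. if U \<union> B \<subseteq> t then pmf P t else 0) =
          (\<Sum>B\<in>ksubsets (t - U) b. pmf P t)"
        using V t True by (intro sum.mono_neutral_cong_right) (auto simp: ksubsets_def)
      also have "\<dots> = real (card (ksubsets (t - U) b)) * pmf P t" by simp
      also have "card (ksubsets (t - U) b) = card (t - U) choose b"
        unfolding ksubsets_def using V t by (intro n_subsets) (auto intro: finite_subset)
      also have "card (t - U) = d - card U" using assms True t by (simp add: card_Diff_subset)
      finally show ?thesis using True by simp
    qed simp
  qed
  also have "\<dots> = real ((d - card U) choose b) * up_prob P U"
    by (simp add: up_prob_conv_sum[OF finite_support] sum_distrib_left)
  finally show ?thesis .
qed

lemma sum_swap_kernel:
  assumes "finite s" "finite A"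
  shows "(\<Sum>B\<in>ksubsets V b. swap_kernel P s A B) =
    (if A \<inter> s = {} then real ((d - card s - card A) choose b) * up_prob P (s \<union> A) else 0)"
proof (cases "A \<inter> s = {}")
  case True
  have "(\<Sum>B\<in>ksubsets V b. swap_kernel P s A B) = (\<Sum>B\<in>ksubsets (V - (s \<union> A)) b. up_prob P (s \<union> A \<union> B))"
    using V True
    by (intro sum.mono_neutral_cong_right) (auto simp: ksubsets_def swap_kernel_def)
  also have "\<dots> = real ((d - card (s \<union> A)) choose b) * up_prob P (s \<union> A)"
    using assms by (intro sum_up_prob) simp
  also have "card (s \<union> A) = card s + card A" using assms True by (simp add: card_Un_disjoint Int_commute)
  finally show ?thesis using True by simp
qed (simp add: swap_kernel_def)

text \<open>Moving v from the centre of the link into A changes neither the union nor the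
  disjointness conditions. This is how an edge with v in A becomes an edge in the link of v.\<close>

lemma swap_kernel_insert:
  assumes "v \<notin> s" "v \<notin> A"
  shows "swap_kernel P (insert v s) A B = swap_kernel P s (insert v A) B"
  using assms by (auto simp: swap_kernel_def)

text \<open>Forgetting A but remembering v leaves an edge from v to B. The other elements of A form
  an a-subset of what a top face retains after s, v and B are removed; its size is
  \<open>d - card s - Suc b\<close>, so the factor is the same for all v and B.\<close>

lemma sum_swap_kernel_containing:
  assumes "finite s" "v \<in> V" "B \<in> ksubsets V b"
  shows "(\<Sum>A\<in>ksubsets V (Suc a). if v \<in> A then swap_kernel P s A B else 0) =
    real ((d - card s - Suc b) choose a) * swap_kernel P s {v} B"
proof (cases "v \<in> s")
  case True
  thus ?thesis by (auto simp: swap_kernel_def intro!: sum.neutral)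
next
  case False
  have B: "finite B" "card B = b" using assms(3) V by (auto simp: ksubsets_def intro: finite_subset)
  have inj: "inj_on (insert v) {A \<in> ksubsets V a. v \<notin> A}" by (auto simp: inj_on_def)
  have image: "insert v ` {A \<in> ksubsets V a. v \<notin> A} = {A \<in> ksubsets V (Suc a). v \<in> A}"
  proof (intro equalityI subsetI)
    fix A assume "A \<in> {A \<in> ksubsets V (Suc a). v \<in> A}"
    hence "A - {v} \<in> {A \<in> ksubsets V a. v \<notin> A}" "A = insert v (A - {v})"
      using V by (auto simp: ksubsets_def)
    thus "A \<in> insert v ` {A \<in> ksubsets V a. v \<notin> A}" by blast
  qed (use assms(2) V in \<open>auto simp: ksubsets_def card_insert_if dest: finite_subset\<close>)
  have "(\<Sum>A\<in>ksubsets V (Suc a). if v \<in> A then swap_kernel P s A B else 0) =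
      (\<Sum>A\<in>insert v ` {A \<in> ksubsets V a. v \<notin> A}. swap_kernel P s A B)"
    unfolding image using V by (intro sum.mono_neutral_cong_right) auto
  also have "\<dots> = (\<Sum>A\<in>{A \<in> ksubsets V a. v \<notin> A}. swap_kernel P s (insert v A) B)"
    by (simp add: sum.reindex[OF inj])
  also have "\<dots> = (\<Sum>A\<in>ksubsets V a. swap_kernel P (insert v s) B A)"
  proof (rule sum.mono_neutral_cong_left)
    show "\<forall>A\<in>ksubsets V a - {A \<in> ksubsets V a. v \<notin> A}. swap_kernel P (insert v s) B A = 0"
      by (auto simp: swap_kernel_def)
    show "swap_kernel P s (insert v A) B = swap_kernel P (insert v s) B A"
      if "A \<in> {A \<in> ksubsets V a. v \<notin> A}" for A
      using that False by (simp add: swap_kernel_insert swap_kernel_commute[of P "insert v s" B])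
  qed (use V in auto)
  also have "\<dots> = real ((d - card s - Suc b) choose a) * swap_kernel P s {v} B"
    using assms(1) B False by (simp add: sum_swap_kernel) (auto simp: swap_kernel_def Un_ac)
  finally show ?thesis .
qed

text \<open>The localisation step, with the edge weighted once for each choice of a marked vertex v
  in A.\<close>

lemma mixing_swap_kernel_Suc:
  assumes s: "finite s" and "\<mu> \<ge> 0" "\<nu> \<ge> 0"
    and local_mix: "\<And>v. v \<in> V - s \<Longrightarrow> mixing \<mu> (ksubsets V a) (ksubsets V b) (swap_kernel P (insert v s))"
    and global_mix: "mixing \<nu> (ksubsets V 1) (ksubsets V b) (swap_kernel P s)"
  shows "mixing (\<mu> + \<nu>) (ksubsets V (Suc a)) (ksubsets V b) (swap_kernel P s)"
proof -
  define q where "q v A B = (if v \<in> A then swap_kernel P s A B else 0)" for v A B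
  have "mixing (\<mu> + \<nu>) (ksubsets V (Suc a)) (ksubsets V b) (\<lambda>A B. \<Sum>v\<in>V. q v A B)"
  proof (rule mixing_localization[OF _ \<open>\<mu> \<ge> 0\<close> \<open>\<nu> \<ge> 0\<close>])
    fix v assume v: "v \<in> V"
    show "mixing \<mu> (ksubsets V (Suc a)) (ksubsets V b) (q v)"
    proof (cases "v \<in> s")
      case True
      thus ?thesis by (intro mixing_zero) (auto simp: q_def swap_kernel_def)
    next
      case False
      \<comment> \<open>Sets containing v have weight 0 in the link of \<open>insert v s\<close>.
        Without them \<open>insert v\<close> is injective.\<close>
      have "mixing \<mu> {A \<in> ksubsets V a. v \<notin> A} (ksubsets V b) (swap_kernel P (insert v s))"
        by (rule mixing_restrict[OF _ _ _ local_mix]) (use V v False in \<open>auto simp: swap_kernel_def\<close>)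
      thus ?thesis
      proof (rule mixing_reindex[where \<phi> = "insert v", rotated 4])
        show "insert v ` {A \<in> ksubsets V a. v \<notin> A} \<subseteq> ksubsets V (Suc a)"
          using v V by (auto simp: ksubsets_def card_insert_if dest: finite_subset)
        fix A B assume A: "A \<in> ksubsets V (Suc a) - insert v ` {A \<in> ksubsets V a. v \<notin> A}"
        have "v \<notin> A"
        proof
          assume "v \<in> A"
          hence "A - {v} \<in> {A \<in> ksubsets V a. v \<notin> A}" "A = insert v (A - {v})"
            using A V by (auto simp: ksubsets_def)
          thus False using A by blast
        qed
        thus "q v A B = 0" by (simp add: q_def)
      qed (use V False in \<open>auto simp: inj_on_def q_def swap_kernel_insert\<close>)
    qed
  next
    let ?c = "real ((d - card s - Suc b) choose a)"
    \<comment> \<open>The marked vertices range over V, the global kernel over singletons;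
      \<open>the_elem\<close> translates.\<close>
    have "mixing \<nu> V (ksubsets V b) (\<lambda>v B. ?c * swap_kernel P s {v} B)"
    proof (rule mixing_reindex[where \<phi> = the_elem, OF V _ _ _ mixing_scale[OF global_mix, of ?c]])
      show "inj_on the_elem (ksubsets V 1)"
        by (auto simp: inj_on_def ksubsets_def card_1_singleton_iff)
      have "V \<subseteq> the_elem ` ksubsets V 1"
      proof
        fix v assume "v \<in> V"
        hence "{v} \<in> ksubsets V 1" by (simp add: ksubsets_def)
        thus "v \<in> the_elem ` ksubsets V 1" by force
      qed
      thus "?c * swap_kernel P s {v} B = 0" if "v \<in> V - the_elem ` ksubsets V 1" for v B
        using that by blast
    qed (auto simp: ksubsets_def card_1_singleton_iff)
    thus "mixing \<nu> V (ksubsets V b) (\<lambda>v B. \<Sum>A\<in>ksubsets V (Suc a). q v A B)"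
      by (rule mixing_cong) (simp add: q_def sum_swap_kernel_containing[OF s])
  qed (simp add: q_def)
  \<comment> \<open>Each edge has been counted once for each of the \<open>Suc a\<close> elements of
    A.\<close>
  hence "mixing (\<mu> + \<nu>) (ksubsets V (Suc a)) (ksubsets V b)
      (\<lambda>A B. 1 / real (Suc a) * (\<Sum>v\<in>V. q v A B))"
    by (rule mixing_scale) simp
  thus ?thesis
  proof (rule mixing_cong)
    fix A B assume A: "A \<in> ksubsets V (Suc a)"
    have "(\<Sum>v\<in>V. q v A B) = (\<Sum>v\<in>A. swap_kernel P s A B)"
      unfolding q_def using A V by (intro sum.mono_neutral_cong_right) (auto simp: ksubsets_def)
    also have "\<dots> = real (Suc a) * swap_kernel P s A B" using A by (simp add: ksubsets_def)
    finally show "1 / real (Suc a) * (\<Sum>v\<in>V. q v A B) = swap_kernel P s A B" by simp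
  qed
qed

lemma mixing_swap_kernel_commute:
  assumes "mixing \<mu> (ksubsets V a) (ksubsets V b) (swap_kernel P s)"
  shows "mixing \<mu> (ksubsets V b) (ksubsets V a) (swap_kernel P s)"
  using mixing_transpose[OF assms] by (rule mixing_cong) (rule swap_kernel_commute)

lemma mixing_swap_kernel_0: "mixing 0 (ksubsets V 0) (ksubsets V b) (swap_kernel P s)"
  unfolding ksubsets_0[OF V] by (rule mixing_singleton) simp

text \<open>\<open>mixing_swap_kernel_Suc\<close> takes vertices from the left side only. So the
  bound for single vertices against b-sets is proved with the b-sets on the left, each step costing
  \<gamma>, and then transposed to serve as the global term of the induction on a, each step of
  which costs b \<gamma>. Passing to \<open>insert v s\<close> while shrinking the left side
  preserves the size condition.\<close>

theorem mixing_swap_kernel: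
  assumes "\<gamma> \<ge> 0"
    and base: "\<And>s. s \<subseteq> V \<Longrightarrow> card s + 2 \<le> d \<Longrightarrow>
      mixing \<gamma> (ksubsets V 1) (ksubsets V 1) (swap_kernel P s)"
    and "s \<subseteq> V" and "card s + a + b \<le> d"
  shows "mixing (real (a * b) * \<gamma>) (ksubsets V a) (ksubsets V b) (swap_kernel P s)"
proof -
  have fin: "finite s" if "s \<subseteq> V" for s using that V by (rule finite_subset)
  have one: "mixing (real b * \<gamma>) (ksubsets V b) (ksubsets V 1) (swap_kernel P s)"
    if "s \<subseteq> V" "card s + b + 1 \<le> d" for s b
    using that
  proof (induction b arbitrary: s)
    case 0
    show ?case using mixing_swap_kernel_0 by simp
  next
    case (Suc b)
    have "mixing (real b * \<gamma> + \<gamma>) (ksubsets V (Suc b)) (ksubsets V 1) (swap_kernel P s)"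
    proof (rule mixing_swap_kernel_Suc)
      fix v assume "v \<in> V - s"
      thus "mixing (real b * \<gamma>) (ksubsets V b) (ksubsets V 1) (swap_kernel P (insert v s))"
        using Suc.prems fin[of s] by (intro Suc.IH) auto
    qed (use Suc.prems \<open>\<gamma> \<ge> 0\<close> fin base in auto)
    thus ?case by (simp add: algebra_simps)
  qed
  show ?thesis
    using assms(3,4)
  proof (induction a arbitrary: s)
    case 0
    show ?case using mixing_swap_kernel_0 by simp
  next
    case (Suc a)
    have "mixing (real (a * b) * \<gamma> + real b * \<gamma>) (ksubsets V (Suc a)) (ksubsets V b) (swap_kernel P s)"
    proof (rule mixing_swap_kernel_Suc)
      fix v assume "v \<in> V - s"
      thus "mixing (real (a * b) * \<gamma>) (ksubsets V a) (ksubsets V b) (swap_kernel P (insert v s))"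
        using Suc.prems fin[of s] by (intro Suc.IH) auto
    next
      show "mixing (real b * \<gamma>) (ksubsets V 1) (ksubsets V b) (swap_kernel P s)"
        by (rule mixing_swap_kernel_commute[OF one]) (use Suc.prems in auto)
    qed (use Suc.prems \<open>\<gamma> \<ge> 0\<close> fin in auto)
    thus ?case by (simp add: algebra_simps)
  qed
qed

end

section \<open>Swap walks on expanders\<close>

lemma pmf_map_remove:
  assumes "finite t" "t \<noteq> {}"
  shows "pmf (map_pmf (\<lambda>x. t - {x}) (pmf_of_set t)) s =
    (if \<exists>x. x \<notin> s \<and> t = insert x s then 1 / real (card t) else 0)"
proof -
  define E where "E \<longleftrightarrow> (\<exists>x. x \<notin> s \<and> t = insert x s)"
  have "pmf (map_pmf (\<lambda>x. t - {x}) (pmf_of_set t)) s = real (card (t \<inter> {x. t - {x} = s})) / real (card t)"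
    using assms by (simp add: pmf_map measure_pmf_of_set vimage_def)
  moreover have "card (t \<inter> {x. t - {x} = s}) = (if E then 1 else 0)"
  proof (cases E)
    case True
    then obtain x where "x \<notin> s" "t = insert x s" unfolding E_def by blast
    hence "t \<inter> {x. t - {x} = s} = {x}" by auto
    thus ?thesis using True by simp
  next
    case False
    hence "t \<inter> {x. t - {x} = s} = {}" unfolding E_def by blast
    thus ?thesis using False by simp
  qed
  ultimately show ?thesis unfolding E_def[symmetric] by simp
qed

lemma set_pmf_delete_random:
  fixes V :: "nat set"
  assumes "finite V" and "set_pmf Q \<subseteq> ksubsets V (Suc i)"
  shows "set_pmf (delete_random Q) \<subseteq> ksubsets V i"
proof
  fix s assume "s \<in> set_pmf (delete_random Q)"
  then obtain t where t: "t \<in> set_pmf Q" "s \<in> set_pmf (map_pmf (\<lambda>x. t - {x}) (pmf_of_set t))"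
    by (auto simp: delete_random_def)
  hence tV: "t \<subseteq> V" "card t = Suc i" using assms(2) by (auto simp: ksubsets_def)
  hence "finite t" "t \<noteq> {}" by (auto intro: card_ge_0_finite)
  then obtain x where "x \<in> t" "s = t - {x}" using t(2) by auto
  thus "s \<in> ksubsets V i" using tV \<open>finite t\<close> by (auto simp: ksubsets_def)
qed

lemma set_pmf_marginal:
  assumes "finite V" and "set_pmf P \<subseteq> ksubsets V d" and "i \<le> d"
  shows "set_pmf (marginal P d i) \<subseteq> ksubsets V i"
proof -
  have "set_pmf ((delete_random ^^ j) P) \<subseteq> ksubsets V (d - j)" if "j \<le> d" for j
    using that
  proof (induction j)
    case (Suc j)
    hence "set_pmf ((delete_random ^^ j) P) \<subseteq> ksubsets V (Suc (d - Suc j))"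
      by (simp add: Suc_diff_Suc)
    thus ?case using set_pmf_delete_random[OF assms(1)] by simp
  qed (use assms in simp)
  from this[of "d - i"] show ?thesis using assms(3) by (simp add: marginal_def)
qed

text \<open>The only sets that can lead to s are \<open>insert x s\<close>, and each loses x with
  probability 1 / (i + 1).\<close>

lemma pmf_delete_random:
  fixes V :: "nat set"
  assumes V: "finite V" and Q: "set_pmf Q \<subseteq> ksubsets V (Suc i)" and s: "s \<in> ksubsets V i"
  shows "pmf (delete_random Q) s = (\<Sum>x\<in>V - s. pmf Q (insert x s)) / real (Suc i)"
proof -
  have sV: "s \<subseteq> V" "card s = i" "finite s" using s V by (auto simp: ksubsets_def intro: finite_subset)
  have inj: "inj_on (\<lambda>x. insert x s) (V - s)" by (auto simp: inj_on_def)
  have "pmf (delete_random Q) s =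
      measure_pmf.expectation Q (\<lambda>t. pmf (map_pmf (\<lambda>x. t - {x}) (pmf_of_set t)) s)"
    by (simp add: delete_random_def pmf_bind)
  also have "\<dots> = (\<Sum>t\<in>ksubsets V (Suc i). pmf (map_pmf (\<lambda>x. t - {x}) (pmf_of_set t)) s * pmf Q t)"
    using V Q by (intro integral_measure_pmf_real) auto
  also have "\<dots> = (\<Sum>t\<in>(\<lambda>x. insert x s) ` (V - s). 1 / real (Suc i) * pmf Q t)"
  proof (rule sum.mono_neutral_cong_right)
    show "(\<lambda>x. insert x s) ` (V - s) \<subseteq> ksubsets V (Suc i)"
      using sV by (auto simp: ksubsets_def)
    have t: "finite t" "t \<noteq> {}" "card t = Suc i" "t \<subseteq> V" if "t \<in> ksubsets V (Suc i)" for t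
      using that V by (auto simp: ksubsets_def intro: finite_subset)
    show "\<forall>t\<in>ksubsets V (Suc i) - (\<lambda>x. insert x s) ` (V - s).
        pmf (map_pmf (\<lambda>x. t - {x}) (pmf_of_set t)) s * pmf Q t = 0"
    proof
      fix t assume "t \<in> ksubsets V (Suc i) - (\<lambda>x. insert x s) ` (V - s)"
      hence "\<nexists>x. x \<notin> s \<and> t = insert x s" "t \<in> ksubsets V (Suc i)" by (auto simp: ksubsets_def)
      thus "pmf (map_pmf (\<lambda>x. t - {x}) (pmf_of_set t)) s * pmf Q t = 0"
        using t by (auto simp: pmf_map_remove)
    qed
    fix u assume u: "u \<in> (\<lambda>x. insert x s) ` (V - s)"
    hence "u \<in> ksubsets V (Suc i)" using sV by (auto simp: ksubsets_def)
    moreover have "\<exists>x. x \<notin> s \<and> u = insert x s" using u by auto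
    ultimately have "pmf (map_pmf (\<lambda>x. u - {x}) (pmf_of_set u)) s = 1 / real (Suc i)"
      using pmf_map_remove[OF t(1,2)] t(3) by simp
    thus "pmf (map_pmf (\<lambda>x. u - {x}) (pmf_of_set u)) s * pmf Q u = 1 / real (Suc i) * pmf Q u"
      by simp
  qed (use V in simp)
  also have "\<dots> = (\<Sum>x\<in>V - s. pmf Q (insert x s)) / real (Suc i)"
    by (simp add: sum.reindex[OF inj] sum_divide_distrib)
  finally show ?thesis .
qed

lemma sum_up_prob_insert:
  assumes V: "finite V" and P: "set_pmf P \<subseteq> ksubsets V d" and "finite s"
  shows "(\<Sum>x\<in>V - s. up_prob P (insert x s)) = real (d - card s) * up_prob P s"
proof -
  have inj: "inj_on (\<lambda>x. {x}) (V - s)" by simp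
  have "ksubsets (V - s) 1 = (\<lambda>x. {x}) ` (V - s)"
    by (auto simp: ksubsets_def card_1_singleton_iff)
  hence "(\<Sum>x\<in>V - s. up_prob P (insert x s)) = (\<Sum>B\<in>ksubsets (V - s) 1. up_prob P (s \<union> B))"
    by (simp add: sum.reindex[OF inj])
  also have "\<dots> = real (d - card s) * up_prob P s"
    using sum_up_prob[OF V P assms(3), of 1] by simp
  finally show ?thesis .
qed

text \<open>Deleting d - i random elements leaves a uniformly random i-subset of the top face, so
  each s contained in it is hit with probability 1 / (d choose i).\<close>

lemma pmf_marginal:
  fixes V :: "nat set"
  assumes V: "finite V" and P: "set_pmf P \<subseteq> ksubsets V d" and "i \<le> d" and s: "s \<in> ksubsets V i"
  shows "pmf (marginal P d i) s = up_prob P s / real (d choose i)"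
proof -
  have "pmf ((delete_random ^^ j) P) s = up_prob P s / real (d choose j)"
    if "j \<le> d" "s \<in> ksubsets V (d - j)" for j s
    using that
  proof (induction j arbitrary: s)
    case 0
    have "up_prob P s = (\<Sum>t\<in>set_pmf P. if s \<subseteq> t then pmf P t else 0)"
      by (rule up_prob_conv_sum[OF finite_support[OF V P]])
    also have "\<dots> = (\<Sum>t\<in>set_pmf P. if t = s then pmf P t else 0)"
    proof (intro sum.cong refl)
      fix t assume "t \<in> set_pmf P"
      hence "finite t" "card t = d" using P V by (auto simp: ksubsets_def intro: finite_subset)
      hence "s \<subseteq> t \<longleftrightarrow> t = s" using 0 card_subset_eq[of t s] by (auto simp: ksubsets_def)
      thus "(if s \<subseteq> t then pmf P t else 0) = (if t = s then pmf P t else 0)" by simp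
    qed
    also have "\<dots> = pmf P s"
      using finite_support[OF V P] by (simp add: sum.delta' set_pmf_iff)
    finally show ?case by simp
  next
    case (Suc j)
    define i where "i = d - Suc j"
    have i: "Suc i = d - j" "i \<le> d" using Suc.prems(1) by (auto simp: i_def)
    have s: "s \<in> ksubsets V i" using Suc.prems by (simp add: i_def)
    hence sV: "finite s" "card s = i" "s \<subseteq> V" using V by (auto simp: ksubsets_def intro: finite_subset)
    have Q: "set_pmf ((delete_random ^^ j) P) \<subseteq> ksubsets V (Suc i)"
      using set_pmf_marginal[OF V P, of "d - j"] Suc.prems(1) i by (simp add: marginal_def)
    have "pmf ((delete_random ^^ Suc j) P) s =
        (\<Sum>x\<in>V - s. pmf ((delete_random ^^ j) P) (insert x s)) / real (Suc i)"
      using pmf_delete_random[OF V Q s] by simp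
    also have "\<dots> = (\<Sum>x\<in>V - s. up_prob P (insert x s) / real (d choose j)) / real (Suc i)"
    proof (intro arg_cong2[where f = "(/)"] sum.cong refl)
      fix x assume "x \<in> V - s"
      hence "insert x s \<in> ksubsets V (d - j)" using sV i by (auto simp: ksubsets_def)
      thus "pmf ((delete_random ^^ j) P) (insert x s) = up_prob P (insert x s) / real (d choose j)"
        using Suc.IH Suc.prems by simp
    qed
    also have "\<dots> = real (Suc j) * up_prob P s / real (d choose j) / real (Suc i)"
      using sum_up_prob_insert[OF V P sV(1)] sV(2) Suc.prems(1)
      by (simp add: sum_divide_distrib[symmetric] i_def del: of_nat_Suc)
    also have "\<dots> = up_prob P s / real (d choose Suc j)"
    proof -
      \<comment> \<open>With \<open>Suc i\<close> = d - j, both sides are d times (d - 1) choose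
        j.\<close>
      have "Suc j * (d choose Suc j) = Suc i * (d choose j)"
        unfolding i(1) binomial_absorb_comp by (rule binomial_absorption)
      hence "real (Suc j) * real (d choose Suc j) = real (Suc i) * real (d choose j)"
        by (metis of_nat_mult)
      moreover have "real (d choose Suc j) \<noteq> 0" "real (d choose j) \<noteq> 0"
        using Suc.prems(1) by simp_all
      ultimately show ?thesis by (simp add: field_simps del: of_nat_Suc)
    qed
    finally show ?case .
  qed
  from this[of "d - i"] assms show ?thesis by (simp add: marginal_def binomial_symmetric[of i d])
qed

section \<open>From complexes to swap kernels\<close>

context
  fixes n d :: nat and X :: "nat set set" and P :: "nat set pmf"
  assumes X: "abstract_simplicial_complex n X" and P: "set_pmf P \<subseteq> faces X d"
begin

lemma face_subset: "t \<in> X \<Longrightarrow> s \<subseteq> t \<Longrightarrow> s \<in> X"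
  using X by (simp add: abstract_simplicial_complex_def)

lemma set_pmf_subset_ksubsets: "set_pmf P \<subseteq> ksubsets {1..n} d"
  using P X by (auto simp: faces_def ksubsets_def abstract_simplicial_complex_def)

lemma faces_subset_ksubsets: "faces X i \<subseteq> ksubsets {1..n} i"
  using X by (auto simp: faces_def ksubsets_def abstract_simplicial_complex_def)

lemma up_prob_nonface:
  assumes "s \<notin> X"
  shows "up_prob P s = 0"
proof (rule up_prob_eq_0)
  fix t assume "t \<in> set_pmf P"
  hence "t \<in> X" using P by (auto simp: faces_def)
  thus "\<not> s \<subseteq> t" using assms face_subset by blast
qed

lemma swap_kernel_nonface:
  assumes "A \<in> ksubsets V i - faces X i"
  shows "swap_kernel P s A B = 0" "swap_kernel P s B A = 0"
proof -
  have "A \<notin> X" using assms by (auto simp: ksubsets_def faces_def)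
  hence "s \<union> A \<union> B \<notin> X" using face_subset[of "s \<union> A \<union> B" A] by auto
  thus "swap_kernel P s A B = 0" by (simp add: swap_kernel_def up_prob_nonface)
  thus "swap_kernel P s B A = 0" by (simp add: swap_kernel_commute)
qed

text \<open>On the vertices of the link the kernel is a constant multiple of the skeleton weight,
  because a step of the swap walk between single vertices is a step along an edge. Other singletons,
  and all of them if s is not a face, have weight 0.\<close>

lemma mixing_link:
  assumes "hdx X P d \<gamma>" and "\<gamma> \<ge> 0" and s: "s \<subseteq> {1..n}" "card s + 2 \<le> d"
  shows "mixing \<gamma> (ksubsets {1..n} 1) (ksubsets {1..n} 1) (swap_kernel P s)"
proof (cases "s \<in> X")
  case False
  have "s \<union> A \<union> B \<notin> X" for A B using False face_subset[of "s \<union> A \<union> B" s] by auto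
  thus ?thesis by (intro mixing_zero) (simp add: swap_kernel_def up_prob_nonface)
next
  case True
  define F where "F = faces (link X s) 1"
  define w where "w = skeleton_weight X P d s"
  \<comment> \<open>The factor between \<open>up_prob\<close> and the induced measure on faces of
    size \<open>card s + 2\<close>.\<close>
  define c where "c = real (d choose (card s + 2))"
  have c: "c > 0" using s by (simp add: c_def)
  have fin: "finite s" using s finite_subset by blast
  have F: "F \<subseteq> ksubsets {1..n} 1"
    using X by (fastforce simp: F_def faces_def link_def ksubsets_def abstract_simplicial_complex_def)
  hence finF: "finite F" by (rule finite_subset) simp
  have w: "w u v = 1 / c * swap_kernel P s u v" if uv: "u \<in> F" "v \<in> F" for u v
  proof (cases "u \<union> v \<in> faces (link X s) 2")
    case True
    have card: "card u = 1" "card v = 1" "card (u \<union> v) = 2"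
      using uv True by (auto simp: F_def faces_def)
    hence "u \<inter> v = {}" by (auto simp: card_1_singleton_iff)
    moreover have "u \<inter> s = {}" "v \<inter> s = {}" using uv by (auto simp: F_def faces_def link_def)
    moreover have "s \<union> (u \<union> v) \<in> X" using True by (auto simp: faces_def link_def Un_absorb1 Un_Diff_cancel)
    ultimately have k: "s \<union> (u \<union> v) \<in> ksubsets {1..n} (card s + 2)"
      using card fin X by (auto simp: ksubsets_def abstract_simplicial_complex_def)
        (subst card_Un_disjoint; auto intro: card_ge_0_finite)
    show ?thesis
      using pmf_marginal[OF _ set_pmf_subset_ksubsets s(2) k] True \<open>u \<inter> v = {}\<close> \<open>u \<inter> s = {}\<close> \<open>v \<inter> s = {}\<close>
      by (simp add: w_def skeleton_weight_def swap_kernel_def c_def Un_assoc)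
  next
    case False
    have "swap_kernel P s u v = 0"
    proof (rule ccontr)
      assume nz: "swap_kernel P s u v \<noteq> 0"
      hence disj: "u \<inter> v = {}" "u \<inter> s = {}" "v \<inter> s = {}"
        by (auto simp: swap_kernel_def split: if_splits)
      have "s \<union> (u \<union> v) \<in> X"
        using nz up_prob_nonface[of "s \<union> (u \<union> v)"] by (auto simp: swap_kernel_def Un_assoc split: if_splits)
      moreover have "u \<union> v = (s \<union> (u \<union> v)) - s" using disj by auto
      ultimately have "u \<union> v \<in> link X s" unfolding link_def by blast
      moreover have "card (u \<union> v) = 2"
        using uv disj by (subst card_Un_disjoint) (auto simp: F_def faces_def intro: card_ge_0_finite)
      ultimately show False using False by (simp add: faces_def)
    qed
    thus ?thesis using False by (simp add: w_def skeleton_weight_def)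
  qed
  have wsym: "w u v = w v u" for u v by (simp add: w_def skeleton_weight_def Un_commute)
  \<comment> \<open>One normalisation uses row sums twice, the other row and column sums; they agree
    because w is symmetric.\<close>
  have "normalized_adjacency F w = matrix_on F F (normalized_kernel F F w)"
    unfolding normalized_adjacency_def normalized_kernel_def by (simp add: wsym)
  moreover have "second_singular_value (normalized_adjacency F w) \<le> \<gamma>"
    using assms(1) True s(2) unfolding hdx_def F_def w_def faces_def by blast
  ultimately have "mixing \<gamma> F F w"
    using mixing_of_second_singular_value_le[OF finF finF _ \<open>\<gamma> \<ge> 0\<close>, of w]
    by (simp add: w_def skeleton_weight_def)
  hence "mixing \<gamma> F F (\<lambda>u v. c * w u v)" using c by (intro mixing_scale) auto
  hence mix: "mixing \<gamma> F F (swap_kernel P s)" by (rule mixing_cong) (use c w in simp)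
  have zero: "swap_kernel P s u v = 0" if u: "u \<in> ksubsets {1..n} 1 - F" for u v
  proof (rule ccontr)
    assume nz: "swap_kernel P s u v \<noteq> 0"
    hence "u \<inter> s = {}" "s \<union> u \<union> v \<in> X"
      using up_prob_nonface by (auto simp: swap_kernel_def split: if_splits)
    hence "s \<union> u \<in> X" "u = (s \<union> u) - s"
      using face_subset[of "s \<union> u \<union> v" "s \<union> u"] by auto
    hence "u \<in> link X s" unfolding link_def by blast
    thus False using u by (simp add: F_def faces_def ksubsets_def)
  qed
  have "mixing \<gamma> (ksubsets {1..n} 1) F (swap_kernel P s)"
    using mixing_extend[OF _ F _ mix] zero by simp
  hence "mixing \<gamma> F (ksubsets {1..n} 1) (swap_kernel P s)"
    by (rule mixing_cong[OF mixing_transpose]) (rule swap_kernel_commute)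
  thus ?thesis using mixing_extend[OF _ F, of "ksubsets {1..n} 1" "swap_kernel P s"] zero by simp
qed

text \<open>The scaled kernel is the joint law of the endpoints of a step: a face of size k + l is
  sampled and split at random. Its marginals are the two induced measures, so normalising by row and
  column sums is the same as passing to the normalised indicators.\<close>

lemma swap_walk_matrix:
  assumes kl: "k + l \<le> d"
  shows "operator_matrix (faces X l) (marginal P d l) (faces X k) (marginal P d k) (swap_walk X P d k l)
    = matrix_on (faces X k) (faces X l) (normalized_kernel (faces X k) (faces X l)
        (\<lambda>b a. swap_kernel P {} b a / (real (d choose (k + l)) * real ((k + l) choose l))))"
  unfolding operator_matrix_def
proof (rule matrix_on_cong)
  show fin: "finite (faces X k)" "finite (faces X l)"
    using finite_subset[OF faces_subset_ksubsets] by simp_all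
  fix b a assume b: "b \<in> faces X k" and a: "a \<in> faces X l"
  \<comment> \<open>The first factor turns \<open>up_prob\<close> into the measure on faces of size
    k + l; the second is the number of ways to split such a face.\<close>
  define c where "c = real (d choose (k + l)) * real ((k + l) choose l)"
  define \<nu> where "\<nu> b a = swap_kernel P {} b a / c" for b a
  define \<pi> where "\<pi> i s = pmf (marginal P d i) s" for i s
  note V = finite_atLeastAtMost[of 1 n] and PV = set_pmf_subset_ksubsets
  have bk: "b \<in> ksubsets {1..n} k" and al: "a \<in> ksubsets {1..n} l"
    using a b faces_subset_ksubsets by auto
  have finab: "finite a" "finite b" "card a = l" "card b = k"
    using bk al by (auto simp: ksubsets_def intro: finite_subset)
  have c: "c > 0" using kl by (simp add: c_def)
  \<comment> \<open>Disjoint sets of sizes k and l inside a d-set can be chosen via their union or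
    one after the other, in either order.\<close>
  have choose_kl: "real (d choose (k + l)) * real ((k + l) choose l) = real (d choose k) * real ((d - k) choose l)"
    "real (d choose (k + l)) * real ((k + l) choose l) = real (d choose l) * real ((d - l) choose k)"
  proof -
    have "(d choose (k + l)) * ((k + l) choose k) = (d choose k) * ((d - k) choose l)"
      using choose_mult[of k "k + l" d] kl by simp
    moreover have "(d choose (k + l)) * ((k + l) choose l) = (d choose l) * ((d - l) choose k)"
      using choose_mult[of l "k + l" d] kl by simp
    moreover have "(k + l) choose k = (k + l) choose l" using binomial_symmetric[of k "k + l"] by simp
    ultimately show "real (d choose (k + l)) * real ((k + l) choose l) = real (d choose k) * real ((d - k) choose l)"
      "real (d choose (k + l)) * real ((k + l) choose l) = real (d choose l) * real ((d - l) choose k)"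
      by (metis of_nat_mult)+
  qed
  have marg: "(\<Sum>x\<in>faces X j. \<nu> y x) = \<pi> i y"
    if y: "y \<in> ksubsets {1..n} i" and "i + j = k + l"
      and ij: "c = real (d choose i) * real ((d - i) choose j)" for i j y
  proof -
    have fy: "finite y" "card y = i" using y by (auto simp: ksubsets_def intro: finite_subset)
    have "i \<le> d" using that(2) kl by simp
    have cancel: "C * u / (D * C) = u / D" if "D * C > 0" for C D u :: real using that by auto
    have "(\<Sum>x\<in>faces X j. swap_kernel P {} y x) = (\<Sum>x\<in>ksubsets {1..n} j. swap_kernel P {} y x)"
      by (rule sum.mono_neutral_left[OF _ faces_subset_ksubsets]) (simp, blast intro: swap_kernel_nonface(2))
    also have "\<dots> = real ((d - i) choose j) * up_prob P y"
      using sum_swap_kernel[OF V PV, of "{}" y j] fy by simp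
    finally have "(\<Sum>x\<in>faces X j. \<nu> y x) = real ((d - i) choose j) * up_prob P y / c"
      by (simp add: \<nu>_def flip: sum_divide_distrib)
    also have "\<dots> = up_prob P y / real (d choose i)"
      using c unfolding ij by (rule cancel)
    also have "\<dots> = \<pi> i y" unfolding \<pi>_def using pmf_marginal[OF V PV \<open>i \<le> d\<close> y] by simp
    finally show ?thesis .
  qed
  have row: "(\<Sum>x\<in>faces X l. \<nu> b x) = \<pi> k b"
    using bk choose_kl by (intro marg) (auto simp: c_def)
  have "(\<Sum>y\<in>faces X k. \<nu> y a) = (\<Sum>y\<in>faces X k. \<nu> a y)"
    by (simp add: \<nu>_def swap_kernel_commute)
  also have "\<dots> = \<pi> l a" using al choose_kl by (intro marg) (auto simp: c_def)
  finally have col: "(\<Sum>y\<in>faces X k. \<nu> y a) = \<pi> l a" .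
  have "swap_walk X P d k l (unit_indicator (marginal P d l) a) b = \<nu> b a / (\<pi> k b * sqrt (\<pi> l a))"
  proof -
    let ?g = "\<lambda>t. 1 / real ((k + l) choose l) * (\<pi> (k + l) t / \<pi> k b) *
      unit_indicator (marginal P d l) a (t - b)"
    let ?S = "{t \<in> faces X (k + l). b \<subseteq> t}"
    have finS: "finite ?S" using finite_subset[OF faces_subset_ksubsets[of "k + l"]] by simp
    \<comment> \<open>From b the walk arrives at a only through the face a \<union> b.\<close>
    have "(\<Sum>t\<in>?S. ?g t) = (\<Sum>t\<in>?S \<inter> {a \<union> b}. ?g t)"
    proof (rule sum.mono_neutral_right)
      show "\<forall>t\<in>?S - ?S \<inter> {a \<union> b}. ?g t = 0"
      proof
        fix t assume "t \<in> ?S - ?S \<inter> {a \<union> b}"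
        hence "t - b \<noteq> a" by auto
        thus "?g t = 0" by (simp add: unit_indicator_def)
      qed
    qed (use finS in auto)
    also have "\<dots> = \<nu> b a / (\<pi> k b * sqrt (\<pi> l a))"
    proof (cases "a \<inter> b = {} \<and> a \<union> b \<in> X")
      case True
      hence card: "card (a \<union> b) = k + l" using finab by (simp add: card_Un_disjoint)
      hence "a \<union> b \<in> faces X (k + l)" using True by (simp add: faces_def)
      hence "\<pi> (k + l) (a \<union> b) = up_prob P (a \<union> b) / real (d choose (k + l))"
        unfolding \<pi>_def using pmf_marginal[OF V PV kl] faces_subset_ksubsets by blast
      moreover have "a \<union> b - b = a" using True by auto
      moreover have "?S \<inter> {a \<union> b} = {a \<union> b}" using \<open>a \<union> b \<in> faces X (k + l)\<close> by auto
      ultimately show ?thesis using True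
        by (simp add: unit_indicator_def \<nu>_def \<pi>_def swap_kernel_def c_def Int_commute Un_commute mult_ac)
    next
      case False
      have g0: "?g t = 0" if "t \<in> ?S \<inter> {a \<union> b}" for t
      proof -
        have "t - b \<noteq> a" using that False by (auto simp: faces_def)
        thus ?thesis by (simp add: unit_indicator_def)
      qed
      have "swap_kernel P {} b a = 0"
        using False up_prob_nonface[of "b \<union> a"] by (auto simp: swap_kernel_def Un_commute Int_commute)
      moreover have "(\<Sum>t\<in>?S \<inter> {a \<union> b}. ?g t) = 0" using g0 by (intro sum.neutral) blast
      ultimately show ?thesis by (simp only: \<nu>_def div_0)
    qed
    finally show ?thesis by (simp add: swap_walk_def \<pi>_def)
  qed
  moreover have "inner_pmf (marginal P d k) (unit_indicator (marginal P d k) b) h = sqrt (\<pi> k b) * h b" for h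
  proof -
    have "inner_pmf (marginal P d k) (unit_indicator (marginal P d k) b) h =
        (\<Sum>s\<in>{b}. unit_indicator (marginal P d k) b s * h s * pmf (marginal P d k) s)"
      unfolding inner_pmf_def
      by (rule integral_measure_pmf_real) (auto simp: unit_indicator_def split: split_indicator_asm)
    also have "\<dots> = \<pi> k b / sqrt (\<pi> k b) * h b" by (simp add: unit_indicator_def \<pi>_def)
    also have "\<pi> k b / sqrt (\<pi> k b) = sqrt (\<pi> k b)" by (rule real_div_sqrt) (simp add: \<pi>_def)
    finally show ?thesis .
  qed
  ultimately have "inner_pmf (marginal P d k) (unit_indicator (marginal P d k) b)
      (swap_walk X P d k l (unit_indicator (marginal P d l) a)) =
      sqrt (\<pi> k b) * (\<nu> b a / (\<pi> k b * sqrt (\<pi> l a)))" by simp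
  also have "\<dots> = \<nu> b a / (sqrt (\<pi> k b) * sqrt (\<pi> l a))"
  proof -
    \<comment> \<open>This includes p = 0, where both sides are 0.\<close>
    have "sqrt p * (x / (p * q)) = x / (sqrt p * q)" if "p \<ge> 0" for p q x :: real
    proof -
      have "sqrt p * (x / (p * q)) = (sqrt p / p) * (x / q)" by simp
      also have "sqrt p / p = 1 / sqrt p" using that by (simp add: sqrt_divide_self_eq inverse_eq_divide)
      finally show ?thesis by simp
    qed
    thus ?thesis by (simp add: \<pi>_def)
  qed
  also have "\<dots> = normalized_kernel (faces X k) (faces X l) \<nu> b a"
    by (simp add: normalized_kernel_def row col)
  finally show "inner_pmf (marginal P d k) (unit_indicator (marginal P d k) b)
      (swap_walk X P d k l (unit_indicator (marginal P d l) a)) =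
      normalized_kernel (faces X k) (faces X l)
        (\<lambda>b a. swap_kernel P {} b a / (real (d choose (k + l)) * real ((k + l) choose l))) b a"
    by (simp add: \<nu>_def[abs_def] c_def)
qed

lemma swap_walk_sigma2_le_of_mixing:
  assumes "k + l \<le> d" and "\<mu> \<ge> 0"
    and mix: "mixing \<mu> (ksubsets {1..n} k) (ksubsets {1..n} l) (swap_kernel P {})"
  shows "swap_walk_sigma2 X P d k l \<le> \<mu>"
proof -
  have fin: "finite (faces X k)" "finite (faces X l)"
    using finite_subset[OF faces_subset_ksubsets] by simp_all
  have "mixing \<mu> (faces X k) (ksubsets {1..n} l) (swap_kernel P {})"
    by (rule mixing_restrict[OF _ faces_subset_ksubsets _ mix]) (simp, erule swap_kernel_nonface(1))
  from mixing_restrict[OF _ faces_subset_ksubsets _ mixing_transpose[OF this]]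
  have "mixing \<mu> (faces X l) (faces X k) (\<lambda>a b. swap_kernel P {} b a)"
    using swap_kernel_nonface(2) by simp
  hence "mixing \<mu> (faces X k) (faces X l) (swap_kernel P {})" by (rule mixing_transpose)
  hence "mixing \<mu> (faces X k) (faces X l)
      (\<lambda>b a. 1 / (real (d choose (k + l)) * real ((k + l) choose l)) * swap_kernel P {} b a)"
    by (rule mixing_scale) simp
  from second_singular_value_le_of_mixing[OF fin _ \<open>\<mu> \<ge> 0\<close> this]
  show ?thesis by (simp add: swap_walk_sigma2_def swap_walk_matrix[OF assms(1)])
qed

theorem swap_walk_sigma2_le:
  assumes "hdx X P d \<gamma>" and "k + l \<le> d" and "\<gamma> \<ge> 0"
  shows "swap_walk_sigma2 X P d k l \<le> real (k * l) * \<gamma>"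
proof (rule swap_walk_sigma2_le_of_mixing[OF assms(2)])
  show "mixing (real (k * l) * \<gamma>) (ksubsets {1..n} k) (ksubsets {1..n} l) (swap_kernel P {})"
    by (rule mixing_swap_kernel[OF _ set_pmf_subset_ksubsets \<open>\<gamma> \<ge> 0\<close> mixing_link[OF assms(1,3)]])
      (use assms(2) in auto)
qed (use assms in simp)

lemma swap_walk_sigma2_le_1:
  assumes "k + l \<le> d"
  shows "swap_walk_sigma2 X P d k l \<le> 1"
  by (rule swap_walk_sigma2_le_of_mixing[OF assms]) (auto intro: mixing_one)

end

text \<open>The support of P is not empty, so the empty set is a face; since d \<ge> 2, its link
  bounds \<gamma> below by a second singular value, which is nonnegative.\<close>

lemma hdx_nonneg:
  assumes "abstract_simplicial_complex n X" and "set_pmf P \<subseteq> faces X d" and "hdx X P d \<gamma>" and "2 \<le> d"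
  shows "\<gamma> \<ge> 0"
proof -
  obtain t where "t \<in> set_pmf P" using set_pmf_not_empty[of P] by blast
  hence "{} \<in> X"
    using assms(1,2) unfolding abstract_simplicial_complex_def faces_def by blast
  hence "{} \<in> faces X 0" by (simp add: faces_def)
  hence "second_singular_value
      (normalized_adjacency (faces (link X {}) 1) (skeleton_weight X P d {})) \<le> \<gamma>"
    using assms(3,4) unfolding hdx_def by (metis add_0)
  thus ?thesis using second_singular_value_nonneg order.trans by blast
qed

theorem theorem5p2:
  fixes n d k l :: nat
    and X :: "nat set set"
    and P :: "nat set pmf"
    and \<gamma> :: real
  assumes "abstract_simplicial_complex n X"
    and "pure_upto X d"
    and "set_pmf P \<subseteq> faces X d"
    and "hdx X P d \<gamma>"
    and "d \<ge> k + l"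
    and "k \<le> l"
  shows "swap_walk_sigma2 X P d k l
    \<le> sqrt (\<gamma> * (2 ^ 8 * real k ^ 2 * real l ^ 2 * 2 ^ (2 * k + 4 * l) * real k ^ k))"
proof (cases "k = 0")
  case True
  \<comment> \<open>The claimed bound is 0 because of the factor k^2, whatever the sign of \<gamma>.
    The empty set is the only face of size 0, so all covariances vanish.\<close>
  have "mixing 0 (ksubsets {1..n} k) (ksubsets {1..n} l) (swap_kernel P {})"
    unfolding True by (rule mixing_swap_kernel_0[OF _ set_pmf_subset_ksubsets[OF assms(1,3)]]) simp
  from swap_walk_sigma2_le_of_mixing[OF assms(1,3) assms(5) _ this]
  show ?thesis using True by simp
next
  case False
  hence k: "1 \<le> k" and l: "1 \<le> l" using assms(6) by auto
  have \<gamma>: "\<gamma> \<ge> 0" using hdx_nonneg[OF assms(1,3,4)] k l assms(5) by simp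
  define C where "C = 2 ^ 8 * real k ^ 2 * real l ^ 2 * 2 ^ (2 * k + 4 * l) * real k ^ k"
  \<comment> \<open>The factor k^2 l^2 of the constant accounts for (k l)^2; the remaining factors
    are at least 1.\<close>
  have "(real (k * l))\<^sup>2 * 1 \<le> (real (k * l))\<^sup>2 * (2 ^ 8 * 2 ^ (2 * k + 4 * l) * real k ^ k)"
  proof (rule mult_left_mono)
    have "(1 :: real) \<le> 2 ^ 8 * 2 ^ (2 * k + 4 * l)" "1 \<le> real k ^ k"
      using one_le_power[of "2 :: real" "8 + (2 * k + 4 * l)"] one_le_power[of "real k" k] k
      by (simp_all only: power_add)
    from mult_mono[OF this] show "1 \<le> 2 ^ 8 * 2 ^ (2 * k + 4 * l) * real k ^ k" by simp
  qed simp
  hence C: "(real (k * l))\<^sup>2 \<le> C" by (simp add: C_def power_mult_distrib mult_ac)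
  have "1 \<le> real (k * l)" using k l by (metis mult_le_mono nat_mult_1 of_nat_1 of_nat_le_iff)
  hence "1 \<le> C" using C by (smt (verit) one_le_power)
  have "swap_walk_sigma2 X P d k l \<le> sqrt (\<gamma> * C)"
  proof (cases "\<gamma> \<le> 1")
    case True
    have "(real (k * l) * \<gamma>)\<^sup>2 = \<gamma> * (\<gamma> * (real (k * l))\<^sup>2)" by (simp add: power2_eq_square)
    also have "\<dots> \<le> \<gamma> * (1 * C)" using True \<gamma> C by (intro mult_left_mono mult_mono) auto
    finally have "real (k * l) * \<gamma> \<le> sqrt (\<gamma> * C)" by (intro real_le_rsqrt) simp
    thus ?thesis using swap_walk_sigma2_le[OF assms(1,3,4,5) \<gamma>] by linarith
  next
    case False
    have "1 * 1 \<le> \<gamma> * C" using False \<open>1 \<le> C\<close> by (intro mult_mono) auto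
    hence "1 \<le> sqrt (\<gamma> * C)" by simp
    thus ?thesis using swap_walk_sigma2_le_1[OF assms(1,3,5)] by linarith
  qed
  thus ?thesis by (simp only: C_def)
qed

end
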